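(* Let $0<\alpha<1$, let $I_{\alpha}$ be the discrete Riesz potential, let $q(\cdot):\mathbb{Z}\to[1,\infty)$ be an exponent sequence, and let $\frac{1}{1-\alpha}<s<q_{-}$. If $(q(\cdot)/s)'\in\mathcal{B}$ and $p(\cdot)$ is the exponent sequence given by $\frac{1}{p(i)}=\frac{1}{q(i)}+\alpha$ for all $i\in\mathbb{Z}$, then there exists a positive constant $C$ such that \[ \|I_{\alpha}a\|_{\ell^{q(\cdot)}}\le C\,\|a\|_{\ell^{p(\cdot)}}\qquad\text{for all } a\in\ell^{p(\cdot)}. \]
   Context: For an exponent sequence $p(\cdot):\mathbb{Z}\to[1,\infty)$ put $p_{-}=\inf\{p(i):i\in\mathbb{Z}\}$ and $p_{+}=\sup\{p(i):i\in\mathbb{Z}\}$ (and similarly $q_{-},q_{+}$ for $q(\cdot)$). The space $\ell^{p(\cdot)}=\ell^{p(\cdot)}(\mathbb{Z})$ is the set of complex sequences $a=\{a(i)\}_{i\in\mathbb{Z}}$ with \[ \|a\|_{\ell^{p(\cdot)}}=\inf\Big\{\lambda>0:\sum_{i\in\mathbb{Z}}|a(i)/\lambda|^{p(i)}\le 1\Big\}<\infty . \] The conjugate exponent $p'(\cdot)$ is defined by $\frac{1}{p(i)}+\frac{1}{p'(i)}=1$ for all $i\in\mathbb{Z}$. Here $(q(\cdot)/s)'$ denotes the conjugate exponent of the sequence $i\mapsto q(i)/s$. The discrete Hardy-Littlewood maximal operator is \[ (Ma)(j)=\sup\frac{1}{n-m+1}\sum_{i=m}^{n}|a(i)|,\qquad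 j\in\mathbb{Z}, \] the supremum being over all $m,n\in\mathbb{Z}$ with $m\le j\le n$. Let $\mathcal{P}$ be the set of $p(\cdot):\mathbb{Z}\to[1,\infty)$ with $1<p_{-}\le p_{+}<\infty$, and let $\mathcal{B}$ be the set of $p(\cdot)\in\mathcal{P}$ such that $M$ is bounded on $\ell^{p(\cdot)}$ (i.e. there is a constant $K$ with $\|Ma\|_{\ell^{p(\cdot)}}\le K\|a\|_{\ell^{p(\cdot)}}$ for all $a\in\ell^{p(\cdot)}$). For $0<\alpha<1$, the discrete Riesz potential of $a=\{a(i)\}_{i\in\mathbb{Z}}$ is \[ (I_{\alpha}a)(j)=\sum_{i\ne j}\frac{a(i)}{|i-j|^{1-\alpha}},\qquad j\in\mathbb{Z}; \] it is well defined on $\ell^{p(\cdot)}$ for every $p(\cdot)\in\mathcal{P}$ with $p_{+}<\alpha^{-1}$. *)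

theory Defs
  imports "HOL-Analysis.Analysis"
begin

text \<open>Extended-real bounds, so that an unbounded exponent sequence has upper bound \<open>\<infinity>\<close>.\<close>

definition exponent_lower :: "(int \<Rightarrow> real) \<Rightarrow> ereal" where
  "exponent_lower p = (INF i. ereal (p i))"

definition exponent_upper :: "(int \<Rightarrow> real) \<Rightarrow> ereal" where
  "exponent_upper p = (SUP i. ereal (p i))"

text \<open>The infimum is taken in \<open>ennreal\<close>, so it is \<open>\<infinity>\<close> when no \<open>t\<close> is admissible.\<close>

definition vlp_norm :: "(int \<Rightarrow> real) \<Rightarrow> (int \<Rightarrow> complex) \<Rightarrow> ennreal" where
  "vlp_norm p a =
     Inf (ennreal ` {t. 0 < t \<and>
       (\<Sum>\<^sub>\<infinity>i. ennreal (cmod (a i / complex_of_real t) powr p i)) \<le> 1})"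

definition vlp_space :: "(int \<Rightarrow> real) \<Rightarrow> (int \<Rightarrow> complex) set" where
  "vlp_space p = {a. vlp_norm p a < \<infinity>}"

text \<open>Meaningful for \<open>p i > 1\<close>: see \<open>conjugate_exponent_iff\<close> below.\<close>

definition conjugate_exponent :: "(int \<Rightarrow> real) \<Rightarrow> int \<Rightarrow> real" where
  "conjugate_exponent p i = 1 / (1 - 1 / p i)"

text \<open>The supremum is a real one; by \<open>bdd_above_averages\<close> below it is a genuine
  supremum for every \<open>a\<close> in a variable exponent space.\<close>

definition discrete_maximal :: "(int \<Rightarrow> complex) \<Rightarrow> int \<Rightarrow> complex" where
  "discrete_maximal a j =
     complex_of_real (SUP (m, n) \<in> {(m, n). m \<le> j \<and> j \<le> n}.
       1 / real_of_int (n - m + 1) * (\<Sum>i = m..n. cmod (a i)))"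

definition exponents_P :: "(int \<Rightarrow> real) set" where
  "exponents_P = {p. (\<forall>i. 1 \<le> p i) \<and> 1 < exponent_lower p \<and> exponent_upper p < \<infinity>}"

definition exponents_B :: "(int \<Rightarrow> real) set" where
  "exponents_B = {p \<in> exponents_P.
     \<exists>K::real. K \<ge> 0 \<and>
       (\<forall>a \<in> vlp_space p. vlp_norm p (discrete_maximal a) \<le> ennreal K * vlp_norm p a)}"

text \<open>The sum converges absolutely for the sequences of interest: see
  \<open>riesz_potential_abs_summable\<close> below.\<close>

definition riesz_potential :: "real \<Rightarrow> (int \<Rightarrow> complex) \<Rightarrow> int \<Rightarrow> complex" where
  "riesz_potential \<alpha> a j =
     (\<Sum>\<^sub>\<infinity>i\<in>{i. i \<noteq> j}. a i / complex_of_real (real_of_int \<bar>i - j\<bar> powr (1 - \<alpha>)))"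

lemma conjugate_exponent_iff:
  assumes "1 < p i"
  shows "1 / p i + 1 / r = 1 \<longleftrightarrow> r = conjugate_exponent p i"
  using assms by (cases "r = 0") (auto simp: conjugate_exponent_def field_simps)

lemma vlp_spaceE:
  assumes "a \<in> vlp_space p"
  obtains l where "0 < l" "(\<lambda>i. (cmod (a i) / l) powr p i) summable_on UNIV"
    "\<And>i. (cmod (a i) / l) powr p i \<le> 1"
proof -
  have "\<exists>l. 0 < l \<and> (\<Sum>\<^sub>\<infinity>i. ennreal (cmod (a i / complex_of_real l) powr p i)) \<le> 1"
  proof (rule ccontr)
    assume "\<not> ?thesis"
    then have e: "{l. 0 < l \<and> (\<Sum>\<^sub>\<infinity>i. ennreal (cmod (a i / complex_of_real l) powr p i)) \<le> 1} = {}"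
      by auto
    show False using assms unfolding vlp_space_def vlp_norm_def mem_Collect_eq e by simp
  qed
  then obtain l where l: "0 < l"
    and s: "(\<Sum>\<^sub>\<infinity>i. ennreal ((cmod (a i) / l) powr p i)) \<le> 1"
    by (auto simp: norm_divide)
  have fin: "sum (\<lambda>i. (cmod (a i) / l) powr p i) F \<le> 1" if "finite F" for F
  proof -
    have "ennreal (sum (\<lambda>i. (cmod (a i) / l) powr p i) F)
        = (\<Sum>\<^sub>\<infinity>i\<in>F. ennreal ((cmod (a i) / l) powr p i))"
      using that by simp
    also have "\<dots> \<le> (\<Sum>\<^sub>\<infinity>i. ennreal ((cmod (a i) / l) powr p i))"
      by (intro infsum_mono_neutral nonneg_summable_on_complete) auto
    also note s
    finally show ?thesis by (simp add: ennreal_le_1)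
  qed
  show thesis
  proof
    show "0 < l" by fact
    show "(\<lambda>i. (cmod (a i) / l) powr p i) summable_on UNIV"
      by (rule nonneg_bdd_above_summable_on) (auto intro!: bdd_aboveI2[where M = 1] fin)
    show "(cmod (a i) / l) powr p i \<le> 1" for i
      using fin[of "{i}"] by simp
  qed
qed

lemma powr_le_1_D:
  fixes x r :: real
  assumes "x powr r \<le> 1" "0 \<le> x" "0 < r"
  shows "x \<le> 1"
  using assms by (metis gr_one_powr linorder_not_less)

lemma bdd_above_averages:
  assumes "\<And>i. 1 \<le> p i" "a \<in> vlp_space p"
  shows "bdd_above ((\<lambda>(m, n). 1 / real_of_int (n - m + 1) * (\<Sum>i = m..n. cmod (a i)))
    ` {(m, n). m \<le> j \<and> j \<le> n})"
proof -
  obtain l where l: "0 < l" "\<And>i. (cmod (a i) / l) powr p i \<le> 1"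
    using vlp_spaceE[OF assms(2)] by metis
  have b: "cmod (a i) \<le> l" for i
    using powr_le_1_D[OF l(2)[of i]] l(1) assms(1)[of i] by (auto simp: field_simps)
  have "1 / real_of_int (n - m + 1) * (\<Sum>i = m..n. cmod (a i)) \<le> l" if "m \<le> j" "j \<le> n" for m n
  proof -
    have "(\<Sum>i = m..n. cmod (a i)) \<le> real (card {m..n}) * l"
      by (rule sum_bounded_above) (rule b)
    also have "real (card {m..n}) = real_of_int (n - m + 1)" using that by simp
    finally show ?thesis using that by (simp add: field_simps)
  qed
  then show ?thesis by (intro bdd_aboveI2[where M = l]) auto
qed

lemma summable_int_powr:
  assumes "1 < (t::real)"
  shows "(\<lambda>i::int. real_of_int \<bar>i - j\<bar> powr - t) summable_on UNIV"
proof -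
  have n: "(\<lambda>n::nat. real n powr - t) summable_on UNIV"
    using assms by (intro norm_summable_imp_summable_on) (simp add: summable_real_powr_iff)
  have p: "(\<lambda>i::int. real_of_int \<bar>i\<bar> powr - t) summable_on (int ` UNIV)"
    using n by (subst summable_on_reindex) (auto simp: o_def)
  have m: "(\<lambda>i::int. real_of_int \<bar>i\<bar> powr - t) summable_on ((\<lambda>n. - int n) ` UNIV)"
    using n by (subst summable_on_reindex) (auto simp: o_def inj_on_def)
  have u: "(UNIV :: int set) = range int \<union> range (\<lambda>n. - int n)"
  proof (rule UNIV_eq_I, goal_cases)
    case (1 x)
    then show ?case by (cases x rule: int_cases2) auto
  qed
  have "(\<lambda>i::int. real_of_int \<bar>i\<bar> powr - t) summable_on UNIV"
    unfolding u by (rule summable_on_union[OF p m])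
  moreover have "range (\<lambda>i. i - j) = UNIV"
    by (rule surjI[where f = "\<lambda>i. i + j"]) simp
  ultimately have "(\<lambda>i::int. real_of_int \<bar>i\<bar> powr - t) summable_on range (\<lambda>i. i - j)"
    by simp
  then show ?thesis by (subst (asm) summable_on_reindex) (auto simp: o_def inj_on_def)
qed

lemma riesz_potential_abs_summable:
  assumes "p \<in> exponents_P" "0 < \<alpha>" "exponent_upper p < ereal (1 / \<alpha>)" "a \<in> vlp_space p"
  shows "(\<lambda>i. norm (a i / complex_of_real (real_of_int \<bar>i - j\<bar> powr (1 - \<alpha>)))) summable_on {i. i \<noteq> j}"
proof -
  obtain l where l: "0 < l" "(\<lambda>i. (cmod (a i) / l) powr p i) summable_on UNIV"
    "\<And>i. (cmod (a i) / l) powr p i \<le> 1"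
    using vlp_spaceE[OF assms(4)] by metis
  have p1: "1 \<le> p i" for i using assms(1) by (auto simp: exponents_P_def)
  define b where "b i = cmod (a i) / l" for i
  have b: "0 \<le> b i" "b i \<le> 1" for i
    using powr_le_1_D[OF l(3)[of i]] l(1) p1[of i] by (auto simp: b_def)
  obtain u where u: "exponent_upper p = ereal u"
  proof (cases "exponent_upper p")
    case MInf
    moreover have "ereal (p 0) \<le> exponent_upper p"
      unfolding exponent_upper_def by (rule SUP_upper) simp
    ultimately show ?thesis by simp
  qed (use assms(3) in auto)
  have pu: "p i \<le> u" for i
  proof -
    have "ereal (p i) \<le> exponent_upper p" unfolding exponent_upper_def by (rule SUP_upper) simp
    then show ?thesis using u by simp
  qed
  have "1 < ereal u"
  proof -
    have "1 < exponent_lower p" using assms(1) by (simp add: exponents_P_def)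
    also have "\<dots> \<le> ereal (p 0)" unfolding exponent_lower_def by (rule INF_lower) auto
    also have "\<dots> \<le> ereal u" using pu by simp
    finally show ?thesis .
  qed
  then have u1: "1 < u" by simp
  have ua: "u * \<alpha> < 1" using assms(2,3) u by (simp add: pos_less_divide_eq)
  define v where "v = u / (u - 1)"
  have v: "1 < v" "1 / u + 1 / v = 1" using u1 by (auto simp: v_def field_simps)
  have t: "1 < (1 - \<alpha>) * v" using u1 ua by (simp add: v_def pos_less_divide_eq algebra_simps)
  have bs: "(\<lambda>i. b i powr u) summable_on UNIV"
  proof (rule summable_on_comparison_test[OF l(2)])
    show "b i powr u \<le> (cmod (a i) / l) powr p i" for i
      using b[of i] pu[of i] by (fold b_def) (rule powr_mono', auto)
  qed auto
  have S: "(\<lambda>i. b i powr u / u + real_of_int \<bar>i - j\<bar> powr - ((1 - \<alpha>) * v) / v) summable_on UNIV"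
    unfolding divide_inverse
    by (intro summable_on_add summable_on_cmult_left bs summable_int_powr t)
  have S': "(\<lambda>i. l * (b i powr u / u + real_of_int \<bar>i - j\<bar> powr - ((1 - \<alpha>) * v) / v))
      summable_on {i. i \<noteq> j}"
    by (intro summable_on_cmult_right summable_on_subset_banach[OF S]) auto
  show ?thesis
  proof (rule summable_on_comparison_test[OF S'])
    fix i assume "i \<in> {i. i \<noteq> j}"
    let ?c = "real_of_int \<bar>i - j\<bar> powr - (1 - \<alpha>)"
    have "b i * ?c \<le> b i powr u / u + ?c powr v / v"
      using u1 v b by (intro Youngs_inequality) auto
    then have "l * (b i * ?c) \<le> l * (b i powr u / u + ?c powr v / v)"
      using l(1) by simp
    moreover have "l * (b i * ?c) =
        norm (a i / complex_of_real (real_of_int \<bar>i - j\<bar> powr (1 - \<alpha>)))"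
      using l(1) by (simp only: powr_minus) (simp add: b_def norm_divide field_simps)
    moreover have "?c powr v = real_of_int \<bar>i - j\<bar> powr - ((1 - \<alpha>) * v)"
      by (simp only: powr_powr) (simp add: algebra_simps)
    ultimately show "norm (a i / complex_of_real (real_of_int \<bar>i - j\<bar> powr (1 - \<alpha>)))
        \<le> l * (b i powr u / u + real_of_int \<bar>i - j\<bar> powr - ((1 - \<alpha>) * v) / v)"
      by simp
  qed auto
qed

end

theory Submission
  imports Defs
begin

text \<open>
  The proof is off-diagonal extrapolation in the style of Rubio de Francia, carried out on finite
  windows of integers with bounds independent of the window, followed by a passage to the limit.

  Put \<open>p\<^sub>0 = s / (1 + \<alpha> * s)\<close>, so that \<open>1 / s = 1 / p\<^sub>0 - \<alpha>\<close> and \<open>p\<^sub>0 > 1\<close>, and write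
  \<open>r = (q / s)'\<close>.  The conjugate exponent of \<open>p / p\<^sub>0\<close> is then \<open>s * r / p\<^sub>0\<close>.  Let \<open>a \<ge> 0\<close>
  have modular at most 1 for \<open>p\<close>.  If the modular of
  \<open>I\<^sub>\<alpha> a / T\<close> for \<open>q\<close> exceeded 1, duality between \<open>q / s\<close> and \<open>r\<close> would give a sequence \<open>h \<ge> 0\<close>
  in the unit ball for \<open>r\<close> with \<open>\<Sum> \<bar>I\<^sub>\<alpha> a / T\<bar>\<^sup>s h \<ge> 1\<close>.  As \<open>M\<close> is bounded for \<open>r\<close>, the
  normalised series of the iterates of \<open>M\<close> on \<open>h\<close> is a weight \<open>w \<ge> h / 2\<close>, still in the unit
  ball for \<open>r\<close>, whose averages over intervals are at most a constant times its value at each of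
  their points, the \<open>A\<^sub>1\<close> condition (\<open>rubio_de_francia_weight\<close>).
  For such weights \<open>I\<^sub>\<alpha>\<close> maps \<open>\<ell>\<^bsup>p\<^sub>0\<^esup>\<close> with weight
  \<open>w\<^bsup>p\<^sub>0/s\<^esup>\<close> to \<open>\<ell>\<^sup>s\<close> with weight \<open>w\<close> (\<open>A1_weighted_riesz_bound\<close>), and Young's inequality
  bounds \<open>\<Sum> \<bar>a\<bar>\<^bsup>p\<^sub>0\<^esup> w\<^bsup>p\<^sub>0/s\<^esup>\<close> by the two modulars, that is by 2.  Hence \<open>\<Sum> \<bar>I\<^sub>\<alpha> a\<bar>\<^sup>s w\<close> is at
  most a constant, which is absurd once \<open>T\<close> is large.

  The weighted inequality uses that the problem is one-dimensional.  Writing \<open>a = g * w\<^sup>\<alpha>\<close>, the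
  \<open>A\<^sub>1\<close> condition bounds the kernel \<open>\<bar>i - j\<bar>\<^bsup>\<alpha>-1\<^esup> w(i)\<^sup>\<alpha>\<close> by a multiple of \<open>W\<^bsup>\<alpha>-1\<^esup> w(i)\<close>, where \<open>W\<close> is the
  mass of \<open>w\<close> between \<open>i\<close> and \<open>j\<close>: the sum becomes a fractional integral in the variable \<open>W\<close>.
  Its two one-sided halves satisfy Hedberg's pointwise inequality against the one-sided maximal
  function with respect to \<open>w\<close>.  That function is bounded on \<open>\<ell>\<^bsup>p\<^sub>0\<^esup>(w)\<close> for every positive weight,
  with a bound independent of the weight, by the rising sun lemma.
\<close>

section \<open>The one-sided maximal function of a positive weight\<close>

text \<open>
  A discrete rising sun lemma.  The case \<open>k = m - 1\<close>, where the left sum is empty, says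
  that \<open>f\<close> has nonnegative sum over the starting points of nonnegative partial sums; arbitrary
  \<open>k\<close> is what makes the induction on the left end point go through.
\<close>

lemma rising_sun_sum:
  fixes f :: "int \<Rightarrow> real"
  assumes "m \<le> n + 1" "m - 1 \<le> k" "k \<le> n"
  shows "sum f {m..k} \<le> sum f {j\<in>{m..n}. \<exists>k\<in>{j..n}. 0 \<le> sum f {j..k}}"
  using assms
proof (induction m arbitrary: k rule: int_le_induct)
  case base
  then show ?case by simp
next
  case (step m k)
  define P where "P j \<longleftrightarrow> (\<exists>k\<in>{j..n}. 0 \<le> sum f {j..k})" for j
  define E where "E m = {j\<in>{m..n}. P j}" for m
  have IH: "sum f {m..l} \<le> sum f (E m)" if "m - 1 \<le> l" "l \<le> n" for l
    using step.IH that unfolding E_def P_def by blast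
  have nonneg: "0 \<le> sum f (E m)" using IH[of "m - 1"] step.hyps by simp
  have split: "sum f {m - 1..l} = f (m - 1) + sum f {m..l}" if "m - 1 \<le> l" for l
  proof -
    have "{m - 1..l} = insert (m - 1) {m..l}" using that by auto
    then show ?thesis by simp
  qed
  have window: "{m - 1..n} = insert (m - 1) {m..n}" using step.hyps by auto
  show ?case
  proof (cases "P (m - 1)")
    case True
    then have "E (m - 1) = insert (m - 1) (E m)" unfolding E_def using window by blast
    moreover have "E m \<subseteq> {m..n}" by (auto simp: E_def)
    then have "finite (E m)" "m - 1 \<notin> E m" by (auto intro: finite_subset)
    ultimately have E: "sum f (E (m - 1)) = f (m - 1) + sum f (E m)" by simp
    have le: "sum f {m - 1..l} \<le> sum f (E (m - 1))" if "m - 1 \<le> l" "l \<le> n" for l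
      using IH that unfolding split[OF that(1)] E by simp
    have "0 \<le> sum f (E (m - 1))" using True le unfolding P_def by fastforce
    then show ?thesis
      using le[of k] step.prems by (cases "k = m - 2") (auto simp: E_def P_def)
  next
    case False
    then have "E (m - 1) = E m" unfolding E_def window by auto
    moreover have "sum f {m - 1..k} \<le> 0"
    proof (cases "k = m - 2")
      case k: False
      then have "k \<in> {m - 1..n}" using step.prems by simp
      then have "\<not> 0 \<le> sum f {m - 1..k}" using False unfolding P_def by blast
      then show ?thesis by simp
    qed simp
    ultimately show ?thesis using nonneg by (simp add: E_def P_def)
  qed
qed

text \<open>
  Doob's argument: multiplying the level set inequality by \<open>t\<^bsup>p-2\<^esup>\<close> and integrating in \<open>t\<close> yields
  \<open>\<Sum> w X\<^sup>p / p \<le> \<Sum> g w X\<^bsup>p-1\<^esup> / (p - 1)\<close>, and half of the left side absorbs the part of the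
  right side where \<open>X\<close> is large compared with \<open>g\<close>.
\<close>

lemma strong_type_from_level_sets:
  fixes X g w :: "'a \<Rightarrow> real"
  assumes "finite A" and p: "1 < p"
    and w: "\<And>x. x \<in> A \<Longrightarrow> 0 \<le> w x" and g: "\<And>x. x \<in> A \<Longrightarrow> 0 \<le> g x"
    and X: "\<And>x. x \<in> A \<Longrightarrow> 0 \<le> X x"
    and weak: "\<And>t. 0 \<le> t \<Longrightarrow> t * (\<Sum>x | x \<in> A \<and> t \<le> X x. w x) \<le> (\<Sum>x | x \<in> A \<and> t \<le> X x. g x * w x)"
  shows "(\<Sum>x\<in>A. w x * X x powr p) \<le> (2 * p / (p - 1)) powr p * (\<Sum>x\<in>A. g x powr p * w x)"
proof -
  define L where "L = sum X A"
  have L: "X x \<le> L" if "x \<in> A" for x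
    unfolding L_def using that \<open>finite A\<close> X by (intro member_le_sum) auto
  have layer: "((\<lambda>t. if t \<le> X x then t powr e else 0) has_integral (X x powr (e + 1) / (e + 1))) {0..L}"
    if "x \<in> A" "- 1 < e" for x e
  proof -
    have "((\<lambda>t. if t \<in> {0..X x} then t powr e else 0) has_integral (X x powr (e + 1) / (e + 1))) {0..L}"
      using L[OF that(1)] X[OF that(1)] has_integral_powr_from_0[OF that(2)]
      by (subst has_integral_restrict) auto
    then show ?thesis by (rule has_integral_eq[rotated]) auto
  qed
  have I1: "((\<lambda>t. \<Sum>x\<in>A. (if t \<le> X x then t powr (p - 1) else 0) * w x) has_integral
      (\<Sum>x\<in>A. X x powr p / p * w x)) {0..L}"
    using layer[of _ "p - 1"] p \<open>finite A\<close> by (intro has_integral_sum has_integral_mult_left) auto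
  have I2: "((\<lambda>t. \<Sum>x\<in>A. (if t \<le> X x then t powr (p - 2) else 0) * (g x * w x)) has_integral
      (\<Sum>x\<in>A. X x powr (p - 1) / (p - 1) * (g x * w x))) {0..L}"
    using layer[of _ "p - 2"] p \<open>finite A\<close> by (intro has_integral_sum has_integral_mult_left) auto
  have main: "(\<Sum>x\<in>A. X x powr p / p * w x) \<le> (\<Sum>x\<in>A. X x powr (p - 1) / (p - 1) * (g x * w x))"
  proof (rule has_integral_le[OF I1 I2])
    fix t assume "t \<in> {0..L}"
    then have t: "0 \<le> t" by simp
    have filt: "(\<Sum>x\<in>A. (if t \<le> X x then c else 0) * u x) = c * (\<Sum>x | x \<in> A \<and> t \<le> X x. u x)"
      for c and u :: "'a \<Rightarrow> real"
      using \<open>finite A\<close> by (auto simp: sum_distrib_left sum.inter_filter intro!: sum.cong)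
    have "t powr (p - 1) = t powr (p - 2) * t"
      using t by (cases "t = 0") (auto simp: powr_mult_base mult.commute)
    then show "(\<Sum>x\<in>A. (if t \<le> X x then t powr (p - 1) else 0) * w x)
        \<le> (\<Sum>x\<in>A. (if t \<le> X x then t powr (p - 2) else 0) * (g x * w x))"
      unfolding filt using weak[OF t] by (simp add: mult.assoc mult_left_mono)
  qed
  \<comment> \<open>The factor 2 makes the term to be absorbed equal to half of the left side.\<close>
  define c where "c = 2 * p / (p - 1)"
  have c: "0 < c" using p by (simp add: c_def)
  have half: "c / 2 = p / (p - 1)" using p by (simp add: c_def field_simps)
  have pointwise: "X x powr (p - 1) * g x \<le> X x powr p / c + c powr (p - 1) * g x powr p" if x: "x \<in> A" for x
  proof (cases "c * g x \<le> X x")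
    case True
    have "X x powr (p - 1) * g x \<le> X x powr (p - 1) * (X x / c)"
      using True c by (intro mult_left_mono) (auto simp: field_simps)
    also have "\<dots> = X x powr p / c"
      using X[OF x] by (cases "X x = 0") (auto simp: powr_mult_base mult.commute)
    finally show ?thesis using c by (smt (verit) mult_nonneg_nonneg powr_ge_zero)
  next
    case False
    have "X x powr (p - 1) * g x \<le> (c * g x) powr (p - 1) * g x"
      using False X[OF x] g[OF x] p by (intro mult_right_mono powr_mono2) auto
    also have "\<dots> = c powr (p - 1) * g x powr p"
      using c g[OF x] by (cases "g x = 0") (auto simp: powr_mult powr_mult_base mult.commute)
    finally show ?thesis using c by (smt (verit) divide_nonneg_pos powr_ge_zero)
  qed
  let ?S = "\<Sum>x\<in>A. w x * X x powr p" and ?G = "\<Sum>x\<in>A. g x powr p * w x"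
  have "?S = p * (\<Sum>x\<in>A. X x powr p / p * w x)"
    using p by (simp add: sum_distrib_left mult.commute)
  also have "\<dots> \<le> p * (\<Sum>x\<in>A. X x powr (p - 1) / (p - 1) * (g x * w x))"
    using main p by (intro mult_left_mono) auto
  also have "\<dots> = c / 2 * (\<Sum>x\<in>A. (X x powr (p - 1) * g x) * w x)"
    unfolding sum_distrib_left half by (intro sum.cong refl) simp
  also have "\<dots> \<le> c / 2 * (\<Sum>x\<in>A. (X x powr p / c + c powr (p - 1) * g x powr p) * w x)"
    using pointwise w c by (intro mult_left_mono sum_mono mult_right_mono) auto
  also have "\<dots> = ?S / 2 + (c * c powr (p - 1)) / 2 * ?G"
    using c by (simp add: sum.distrib sum_distrib_left sum_divide_distrib algebra_simps)
  also have "c * c powr (p - 1) = c powr p" using c by (simp add: powr_mult_base)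
  finally show ?thesis unfolding c_def by (simp add: field_simps)
qed

text \<open>
  Only intervals that start at \<open>j\<close> and stay in the window compete, so this is a maximum over a
  finite set, meaningful for \<open>j \<le> n\<close>.
\<close>

definition forward_maximal :: "(int \<Rightarrow> real) \<Rightarrow> (int \<Rightarrow> real) \<Rightarrow> int \<Rightarrow> int \<Rightarrow> real" where
  "forward_maximal w g n j = (MAX k\<in>{j..n}. (\<Sum>i = j..k. g i * w i) / sum w {j..k})"

lemma forward_maximal_ge:
  assumes "\<And>i. 0 < w i" "j \<le> k" "k \<le> n"
  shows "(\<Sum>i = j..k. g i * w i) \<le> forward_maximal w g n j * sum w {j..k}"
proof -
  have "(\<Sum>i = j..k. g i * w i) / sum w {j..k} \<le> forward_maximal w g n j"
    unfolding forward_maximal_def using assms by (intro Max_ge) auto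
  moreover have "0 < sum w {j..k}" using assms by (intro sum_pos) auto
  ultimately show ?thesis by (simp add: field_simps)
qed

lemma forward_maximal_nonneg:
  assumes "\<And>i. 0 < w i" "\<And>i. 0 \<le> g i" "j \<le> n"
  shows "0 \<le> forward_maximal w g n j"
  using forward_maximal_ge[of w j j n g, OF assms(1) order_refl assms(3)] assms(1)[of j] assms(2)[of j]
  by (simp add: mult_le_cancel_right)

text \<open>
  The level set \<open>{M \<ge> t}\<close> is the set of starting points of nonnegative partial sums of
  \<open>(g - t) * w\<close>, so the rising sun lemma is its weak type inequality, with constant 1.
\<close>

lemma forward_maximal_strong_type:
  fixes w g :: "int \<Rightarrow> real"
  assumes "1 < p" and w: "\<And>i. 0 < w i" and g: "\<And>i. 0 \<le> g i"
  shows "(\<Sum>j = m..n. w j * forward_maximal w g n j powr p)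
    \<le> (2 * p / (p - 1)) powr p * (\<Sum>j = m..n. g j powr p * w j)"
proof (rule strong_type_from_level_sets)
  fix t :: real
  have level: "t \<le> forward_maximal w g n j \<longleftrightarrow> (\<exists>k\<in>{j..n}. 0 \<le> (\<Sum>i = j..k. (g i - t) * w i))"
    if "j \<le> n" for j
  proof -
    have pos: "0 < sum w {j..k}" if "j \<le> k" for k using that w by (intro sum_pos) auto
    have "t \<le> forward_maximal w g n j \<longleftrightarrow> (\<exists>k\<in>{j..n}. t \<le> (\<Sum>i = j..k. g i * w i) / sum w {j..k})"
      unfolding forward_maximal_def using that by (subst Max_ge_iff) auto
    also have "\<dots> \<longleftrightarrow> (\<exists>k\<in>{j..n}. 0 \<le> (\<Sum>i = j..k. (g i - t) * w i))"
      using pos by (intro bex_cong refl)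
        (auto simp: pos_le_divide_eq left_diff_distrib sum_subtractf sum_distrib_left)
    finally show ?thesis .
  qed
  have E: "{j. j \<in> {m..n} \<and> t \<le> forward_maximal w g n j}
      = {j\<in>{m..n}. \<exists>k\<in>{j..n}. 0 \<le> (\<Sum>i = j..k. (g i - t) * w i)}"
    using level by auto
  have "0 \<le> (\<Sum>j | j \<in> {m..n} \<and> t \<le> forward_maximal w g n j. (g j - t) * w j)"
  proof (cases "m \<le> n + 1")
    case True
    then show ?thesis
      using rising_sun_sum[of m n "m - 1" "\<lambda>i. (g i - t) * w i"] unfolding E by simp
  qed (auto intro!: sum_nonneg)
  then show "t * (\<Sum>j | j \<in> {m..n} \<and> t \<le> forward_maximal w g n j. w j)
      \<le> (\<Sum>j | j \<in> {m..n} \<and> t \<le> forward_maximal w g n j. g j * w j)"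
    by (simp add: left_diff_distrib sum_subtractf sum_distrib_left)
qed (use assms forward_maximal_nonneg[OF w g] in \<open>auto intro: less_imp_le\<close>)


section \<open>Hedberg's inequality for the one-sided fractional integral\<close>

text \<open>
  The two comparisons below are the one-step forms of \<open>\<integral> x\<^bsup>\<alpha>-1\<^esup> dx\<close> and \<open>\<integral> x\<^bsup>-\<beta>\<^esup> dx\<close> over
  \<open>[u, v]\<close>, in which the decreasing integrand is estimated by its value at the right end point.
\<close>

lemma powr_diff_le_of_concave:
  fixes u v \<alpha> :: real
  assumes "0 < \<alpha>" "\<alpha> < 1" "0 \<le> u" "u < v"
  shows "(v - u) * v powr (\<alpha> - 1) \<le> (v powr \<alpha> - u powr \<alpha>) / \<alpha>"
proof (cases "u = 0")
  case True
  then show ?thesis using assms by (simp add: powr_mult_base field_simps)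
next
  case False
  then have u: "0 < u" using assms by simp
  have "u powr \<alpha> * v powr (1 - \<alpha>) \<le> \<alpha> * u + (1 - \<alpha>) * v"
    using assms u by (intro Youngs_inequality_0) auto
  then have "u powr \<alpha> * v powr (1 - \<alpha>) * v powr (\<alpha> - 1) \<le> (\<alpha> * u + (1 - \<alpha>) * v) * v powr (\<alpha> - 1)"
    by (intro mult_right_mono) auto
  moreover have "v powr (1 - \<alpha>) * v powr (\<alpha> - 1) = 1"
    using assms u by (simp flip: powr_add)
  moreover have "v * v powr (\<alpha> - 1) = v powr \<alpha>"
    using assms u by (simp add: powr_mult_base)
  ultimately have "u powr \<alpha> \<le> \<alpha> * u * v powr (\<alpha> - 1) + (1 - \<alpha>) * v powr \<alpha>"
    by (simp add: algebra_simps)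
  then show ?thesis
    using assms \<open>v * v powr (\<alpha> - 1) = v powr \<alpha>\<close> by (simp add: field_simps)
qed

lemma powr_diff_le_of_convex:
  fixes u v \<beta> :: real
  assumes "1 < \<beta>" "0 < u" "u < v"
  shows "(v - u) * v powr - \<beta> \<le> (u powr (1 - \<beta>) - v powr (1 - \<beta>)) / (\<beta> - 1)"
proof -
  have "\<exists>z. u < z \<and> z < v \<and> v powr (1 - \<beta>) - u powr (1 - \<beta>) = (v - u) * ((1 - \<beta>) * z powr (- \<beta>))"
    using assms has_real_derivative_powr[of _ "1 - \<beta>"] by (intro MVT2) auto
  then obtain z where z: "u < z" "z < v"
    and e: "v powr (1 - \<beta>) - u powr (1 - \<beta>) = (v - u) * ((1 - \<beta>) * z powr (- \<beta>))" by blast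
  have "(v - u) * v powr - \<beta> \<le> (v - u) * z powr - \<beta>"
    using z assms by (intro mult_left_mono powr_mono2') auto
  also have "\<dots> = (u powr (1 - \<beta>) - v powr (1 - \<beta>)) / (\<beta> - 1)"
    using e assms by (simp add: field_simps)
  finally show ?thesis .
qed

lemma sum_int_extend_right:
  fixes f :: "int \<Rightarrow> real"
  assumes "j \<le> k + 1"
  shows "sum f {j..k + 1} = sum f {j..k} + f (k + 1)"
proof -
  have "{j..k + 1} = insert (k + 1) {j..k}" using assms by auto
  then show ?thesis by simp
qed

text \<open>
  The part of the fractional integral where the accumulated mass is small: summation by parts
  turns the bound on the averages of \<open>g\<close> into \<open>M\<close> times a Riemann sum of \<open>\<integral> x\<^bsup>\<alpha>-1\<^esup> dx\<close>.
\<close>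

lemma near_sum_bound:
  fixes w g :: "int \<Rightarrow> real"
  assumes \<alpha>: "0 < \<alpha>" "\<alpha> < 1" and w: "\<And>i. 0 < w i"
    and avg: "\<And>k. k \<in> {j..n} \<Longrightarrow> (\<Sum>i = j..k. g i * w i) \<le> M * sum w {j..k}" and "0 \<le> M"
    and "j - 1 \<le> n"
  shows "(\<Sum>i = j..n. sum w {j..i} powr (\<alpha> - 1) * (g i * w i)) \<le> M * sum w {j..n} powr \<alpha> / \<alpha>"
proof -
  define V where "V k = sum w {j..k}" for k
  define G where "G k = (\<Sum>i = j..k. g i * w i)" for k
  \<comment> \<open>The subtracted term is the boundary term of the summation by parts; without it the
    induction does not close.\<close>
  have "(\<Sum>i = j..k. V i powr (\<alpha> - 1) * (g i * w i))
      \<le> M * V k powr \<alpha> / \<alpha> - (M * V k - G k) * V k powr (\<alpha> - 1)" if "j - 1 \<le> k" "k \<le> n" for k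
    using that
  proof (induction k rule: int_ge_induct)
    case base
    then show ?case by (simp add: V_def G_def)
  next
    case (step k)
    have V': "V (k + 1) = V k + w (k + 1)" and G': "G (k + 1) = G k + g (k + 1) * w (k + 1)"
      unfolding V_def G_def using step.hyps by (auto intro: sum_int_extend_right)
    have V0: "0 \<le> V k" unfolding V_def using w by (intro sum_nonneg) (auto intro: less_imp_le)
    have VV: "V k < V (k + 1)" using w V' by simp
    have MG: "0 \<le> M * V k - G k"
    proof (cases "k = j - 1")
      case False
      then show ?thesis using avg[of k] step by (simp add: V_def G_def)
    qed (simp add: V_def G_def)
    have "(M * V k - G k) * V (k + 1) powr (\<alpha> - 1) \<le> (M * V k - G k) * V k powr (\<alpha> - 1)"
    proof (cases "V k = 0")
      case True
      then have "\<not> j \<le> k" unfolding V_def using sum_pos[of "{j..k}" w] w by fastforce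
      then show ?thesis by (simp add: V_def G_def)
    next
      case False
      then show ?thesis using MG VV V0 \<alpha> by (intro mult_left_mono powr_mono2') auto
    qed
    moreover have "M * ((V (k + 1) - V k) * V (k + 1) powr (\<alpha> - 1)) \<le> M * ((V (k + 1) powr \<alpha> - V k powr \<alpha>) / \<alpha>)"
      using powr_diff_le_of_concave[OF \<alpha> V0 VV] \<open>0 \<le> M\<close> by (rule mult_left_mono)
    moreover have "(\<Sum>i = j..k + 1. V i powr (\<alpha> - 1) * (g i * w i)) =
        (\<Sum>i = j..k. V i powr (\<alpha> - 1) * (g i * w i)) + V (k + 1) powr (\<alpha> - 1) * (G (k + 1) - G k)"
      using step.hyps by (subst sum_int_extend_right) (auto simp: G')
    moreover have "(\<Sum>i = j..k. V i powr (\<alpha> - 1) * (g i * w i))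
      \<le> M * V k powr \<alpha> / \<alpha> - (M * V k - G k) * V k powr (\<alpha> - 1)"
      using step by simp
    ultimately show ?case by (simp add: algebra_simps diff_divide_distrib)
  qed
  from this[of n] have "(\<Sum>i = j..n. V i powr (\<alpha> - 1) * (g i * w i))
      \<le> M * V n powr \<alpha> / \<alpha> - (M * V n - G n) * V n powr (\<alpha> - 1)"
    using assms by simp
  moreover have "0 \<le> M * V n - G n"
    using avg[of n] assms by (cases "n = j - 1") (auto simp: V_def G_def)
  ultimately have "(\<Sum>i = j..n. V i powr (\<alpha> - 1) * (g i * w i)) \<le> M * V n powr \<alpha> / \<alpha>"
    by (smt (verit) mult_nonneg_nonneg powr_ge_zero)
  then show ?thesis by (simp add: V_def)
qed

text \<open>
  A Riemann sum of \<open>\<integral> x\<^bsup>-\<beta>\<^esup> dx\<close> over \<open>x > t\<close>, which is \<open>t\<^bsup>1-\<beta>\<^esup> / (\<beta> - 1)\<close>.  The step that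
  crosses \<open>t\<close> may start far below \<open>t\<close>; it costs at most another \<open>t\<^bsup>1-\<beta>\<^esup>\<close>.
\<close>

lemma far_weight_sum_bound:
  fixes w :: "int \<Rightarrow> real"
  assumes \<beta>: "1 < \<beta>" and "0 < t" and w: "\<And>i. 0 < w i" and "j - 1 \<le> n"
  shows "(\<Sum>i | i \<in> {j..n} \<and> t < sum w {j..i}. sum w {j..i} powr - \<beta> * w i)
    \<le> \<beta> / (\<beta> - 1) * t powr (1 - \<beta>)"
proof -
  define V where "V k = sum w {j..k}" for k
  define S where "S k = (\<Sum>i = j..k. if t < V i then V i powr - \<beta> * w i else 0)" for k
  have "S k \<le> (if t < V k then \<beta> / (\<beta> - 1) * t powr (1 - \<beta>) - V k powr (1 - \<beta>) / (\<beta> - 1) else 0)"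
    if "j - 1 \<le> k" for k
    using that
  proof (induction k rule: int_ge_induct)
    case base
    then show ?case using \<open>0 < t\<close> by (simp add: V_def S_def)
  next
    case (step k)
    have V': "V (k + 1) = V k + w (k + 1)"
      unfolding V_def using step.hyps by (auto intro: sum_int_extend_right)
    have V0: "0 \<le> V k" unfolding V_def using w by (intro sum_nonneg) (auto intro: less_imp_le)
    have VV: "V k < V (k + 1)" using w V' by simp
    have S': "S (k + 1) = S k + (if t < V (k + 1) then V (k + 1) powr - \<beta> * w (k + 1) else 0)"
      unfolding S_def using step.hyps by (subst sum_int_extend_right) auto
    consider "t < V k" | "V k \<le> t" "t < V (k + 1)" | "V (k + 1) \<le> t" by linarith
    then show ?case
    proof cases
      case 1
      then have "(V (k + 1) - V k) * V (k + 1) powr - \<beta>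
          \<le> (V k powr (1 - \<beta>) - V (k + 1) powr (1 - \<beta>)) / (\<beta> - 1)"
        using \<beta> VV \<open>0 < t\<close> by (intro powr_diff_le_of_convex) auto
      then show ?thesis using 1 VV step.IH S' V' by (simp add: diff_divide_distrib mult.commute)
    next
      case 2
      have "V (k + 1) powr - \<beta> * w (k + 1) \<le> V (k + 1) powr - \<beta> * V (k + 1)"
        using V0 V' by (intro mult_left_mono) auto
      also have "\<dots> = V (k + 1) powr (1 - \<beta>)"
        using 2 \<open>0 < t\<close> by (simp add: mult.commute powr_mult_base)
      also have "\<dots> = \<beta> / (\<beta> - 1) * V (k + 1) powr (1 - \<beta>) - V (k + 1) powr (1 - \<beta>) / (\<beta> - 1)"
        using \<beta> by (simp add: diff_divide_distrib[symmetric]) (simp add: nonzero_eq_divide_eq algebra_simps)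
      also have "\<dots> \<le> \<beta> / (\<beta> - 1) * t powr (1 - \<beta>) - V (k + 1) powr (1 - \<beta>) / (\<beta> - 1)"
        using 2 \<beta> \<open>0 < t\<close> by (intro diff_right_mono mult_left_mono powr_mono2') auto
      finally show ?thesis using 2 step.IH S' by simp
    next
      case 3
      then show ?thesis using VV step.IH S' by simp
    qed
  qed
  from this[of n] have "S n \<le> \<beta> / (\<beta> - 1) * t powr (1 - \<beta>)"
    using assms by (auto split: if_splits intro: order_trans)
  moreover have "S n = (\<Sum>i | i \<in> {j..n} \<and> t < V i. V i powr - \<beta> * w i)"
    unfolding S_def by (rule sum.inter_filter[symmetric]) simp
  ultimately show ?thesis by (simp add: V_def)
qed


text \<open>
  Hedberg's argument: cut the sum where the mass \<open>sum w {j..i}\<close> passes \<open>t\<close>.  The near part is at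
  most \<open>t\<^sup>\<alpha> * M / \<alpha>\<close>; the far part is controlled by the bound \<open>L\<close> on the \<open>p\<close>-th power sum and is of
  order \<open>t\<^bsup>-1/s\<^esup>\<close>.  The choice \<open>t = M\<^bsup>-p\<^esup>\<close> makes both a multiple of \<open>M\<^bsup>p/s\<^esup>\<close>.
\<close>

lemma fractional_integral_pointwise:
  fixes w g :: "int \<Rightarrow> real"
  assumes \<alpha>: "0 < \<alpha>" "\<alpha> < 1" and p: "1 < p" "\<alpha> * p < 1" and s: "1 / s = 1 / p - \<alpha>"
    and w: "\<And>i. 0 < w i" and g: "\<And>i. 0 \<le> g i"
    and L: "(\<Sum>i = j..n. g i powr p * w i) \<le> L" and "j \<le> n"
    and \<beta>: "\<beta> = (1 - \<alpha>) * (p / (p - 1))"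
  shows "(\<Sum>i = j..n. sum w {j..i} powr (\<alpha> - 1) * (g i * w i))
    \<le> (1 / \<alpha> + \<beta> / (\<beta> - 1) + L) * forward_maximal w g n j powr (p / s)"
proof -
  define M where "M = forward_maximal w g n j"
  define V where "V k = sum w {j..k}" for k
  have M0: "0 \<le> M" unfolding M_def using w g \<open>j \<le> n\<close> by (rule forward_maximal_nonneg)
  have avg: "(\<Sum>i = j..k. g i * w i) \<le> M * sum w {j..k}" if "k \<in> {j..n}" for k
    unfolding M_def using that w by (intro forward_maximal_ge) auto
  show ?thesis
  proof (cases "M = 0")
    case True
    have "(\<Sum>i = j..n. sum w {j..i} powr (\<alpha> - 1) * (g i * w i)) \<le> M * sum w {j..n} powr \<alpha> / \<alpha>"
      using \<alpha> w avg M0 \<open>j \<le> n\<close> by (intro near_sum_bound) auto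
    then show ?thesis using True by (simp add: M_def)
  next
    case False
    then have M: "0 < M" using M0 by simp
    have s_pos: "0 < s"
    proof -
      have "\<alpha> < 1 / p" using p by (simp add: pos_less_divide_eq)
      then have "0 < 1 / s" using s by simp
      then show ?thesis by simp
    qed
    have ps: "p / s = 1 - \<alpha> * p"
      using p s s_pos by (simp add: field_simps)
    have \<beta>1: "1 < \<beta>" using p by (simp add: \<beta> field_simps)
    have \<beta>s: "1 - \<beta> = - (p / (p - 1)) / s"
    proof -
      have "1 - \<beta> = - (1 - \<alpha> * p) / (p - 1)" using p by (simp add: \<beta> field_simps)
      then show ?thesis using ps[symmetric] by simp
    qed
    define t where "t = M powr - p"
    have t: "0 < t" using M by (simp add: t_def)
    define near where "near = {i \<in> {j..n}. V i \<le> t}"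
    define far where "far = {i \<in> {j..n}. t < V i}"
    have V_mono: "V i \<le> V k" if "i \<le> k" for i k
      unfolding V_def using that w by (intro sum_mono2) (auto intro: less_imp_le)
    have V_pos: "0 < V i" if "j \<le> i" for i
      unfolding V_def using that w by (intro sum_pos) auto
    have near: "(\<Sum>i\<in>near. V i powr (\<alpha> - 1) * (g i * w i)) \<le> 1 / \<alpha> * M powr (p / s)"
    proof (cases "near = {}")
      case True
      then show ?thesis using \<alpha> by simp
    next
      case False
      define k where "k = Max near"
      have "finite near" by (rule finite_subset[of _ "{j..n}"]) (auto simp: near_def)
      then have k: "k \<in> near" and le: "\<And>i. i \<in> near \<Longrightarrow> i \<le> k"
        unfolding k_def using False by (rule Max_in, intro Max_ge)
      then have kn: "j \<le> k" "k \<le> n" "V k \<le> t" and "near \<subseteq> {j..k}" by (auto simp: near_def)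
      then have "near = {j..k}" using k V_mono[of _ k] by (fastforce simp: near_def)
      then have "(\<Sum>i\<in>near. V i powr (\<alpha> - 1) * (g i * w i)) \<le> M * V k powr \<alpha> / \<alpha>"
        unfolding V_def using \<alpha> w avg M0 kn by (simp only:) (intro near_sum_bound, auto)
      also have "\<dots> \<le> M * t powr \<alpha> / \<alpha>"
        using \<alpha> M0 kn V_pos[of k] by (intro divide_right_mono mult_left_mono powr_mono2) auto
      also have "M * t powr \<alpha> = M powr (p / s)"
        using M by (simp add: t_def powr_powr ps powr_mult_base mult.commute)
      finally show ?thesis by simp
    qed
    define p' where "p' = p / (p - 1)"
    \<comment> \<open>The scaling for which both terms of Young's inequality, summed over the far part, are
      multiples of \<open>M powr (p / s)\<close>.\<close>
    define \<theta> where "\<theta> = M powr - (1 / s)"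
    have p': "1 < p'" "1 / p + 1 / p' = 1" using p by (auto simp: p'_def field_simps)
    have \<theta>: "0 < \<theta>" using M by (simp add: \<theta>_def)
    have young: "V i powr (\<alpha> - 1) * (g i * w i)
        \<le> \<theta> powr p' * (V i powr - \<beta> * w i) + M powr (p / s) * (g i powr p * w i)"
      if i: "i \<in> far" for i
    proof -
      have "(\<theta> * V i powr (\<alpha> - 1)) * (g i / \<theta>) \<le> (\<theta> * V i powr (\<alpha> - 1)) powr p' / p' + (g i / \<theta>) powr p / p"
        using p p' \<theta> g by (intro Youngs_inequality) auto
      also have "\<dots> \<le> (\<theta> * V i powr (\<alpha> - 1)) powr p' + (g i / \<theta>) powr p"
        using p p' by (intro add_mono) (auto simp: divide_le_eq mult_left_le_one_le mult_le_cancel_left1)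
      also have "(\<theta> * V i powr (\<alpha> - 1)) powr p' = \<theta> powr p' * V i powr - \<beta>"
        using \<theta> by (simp add: powr_mult powr_powr \<beta> p'_def[symmetric] left_diff_distrib)
      also have "(g i / \<theta>) powr p = M powr (p / s) * g i powr p"
      proof -
        have "g i / \<theta> = g i * M powr (1 / s)"
          by (simp add: \<theta>_def powr_minus divide_inverse)
        then show ?thesis using g[of i] by (simp add: powr_mult powr_powr mult.commute)
      qed
      finally have "V i powr (\<alpha> - 1) * g i \<le> \<theta> powr p' * V i powr - \<beta> + M powr (p / s) * g i powr p"
        using \<theta> by simp
      then have "V i powr (\<alpha> - 1) * g i * w i \<le> (\<theta> powr p' * V i powr - \<beta> + M powr (p / s) * g i powr p) * w i"
        using w[of i] by (intro mult_right_mono) auto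
      then show ?thesis by (simp add: algebra_simps)
    qed
    have "(\<Sum>i\<in>far. V i powr (\<alpha> - 1) * (g i * w i))
        \<le> (\<Sum>i\<in>far. \<theta> powr p' * (V i powr - \<beta> * w i) + M powr (p / s) * (g i powr p * w i))"
      by (rule sum_mono) (rule young)
    also have "\<dots> = \<theta> powr p' * (\<Sum>i\<in>far. V i powr - \<beta> * w i) + M powr (p / s) * (\<Sum>i\<in>far. g i powr p * w i)"
      by (simp add: sum.distrib sum_distrib_left)
    also have "\<dots> \<le> \<theta> powr p' * (\<beta> / (\<beta> - 1) * t powr (1 - \<beta>)) + M powr (p / s) * L"
    proof (intro add_mono mult_left_mono)
      show "(\<Sum>i\<in>far. V i powr - \<beta> * w i) \<le> \<beta> / (\<beta> - 1) * t powr (1 - \<beta>)"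
        unfolding far_def V_def using \<beta>1 t w \<open>j \<le> n\<close> by (intro far_weight_sum_bound) auto
      have "(\<Sum>i\<in>far. g i powr p * w i) \<le> (\<Sum>i = j..n. g i powr p * w i)"
        using w by (intro sum_mono2) (auto simp: far_def intro!: mult_nonneg_nonneg intro: less_imp_le)
      then show "(\<Sum>i\<in>far. g i powr p * w i) \<le> L" using L by simp
    qed auto
    also have "\<theta> powr p' * (\<beta> / (\<beta> - 1) * t powr (1 - \<beta>)) = \<beta> / (\<beta> - 1) * M powr (p / s)"
    proof -
      have "- (1 / s) * p' + - p * (1 - \<beta>) = p / s"
      proof -
        have "- (1 / s) * p' + - p * (1 - \<beta>) = p' * (p - 1) / s"
          unfolding \<beta>s p'_def[symmetric] using s_pos by (simp add: field_simps)
        also have "p' * (p - 1) = p" using p by (simp add: p'_def)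
        finally show ?thesis .
      qed
      then have "\<theta> powr p' * t powr (1 - \<beta>) = M powr (p / s)"
        unfolding \<theta>_def t_def powr_powr powr_add[symmetric] by simp
      then show ?thesis by (simp add: mult_ac)
    qed
    finally have far: "(\<Sum>i\<in>far. V i powr (\<alpha> - 1) * (g i * w i))
        \<le> \<beta> / (\<beta> - 1) * M powr (p / s) + M powr (p / s) * L" .
    have "(\<Sum>i = j..n. V i powr (\<alpha> - 1) * (g i * w i))
        = (\<Sum>i\<in>near. V i powr (\<alpha> - 1) * (g i * w i)) + (\<Sum>i\<in>far. V i powr (\<alpha> - 1) * (g i * w i))"
      by (subst sum.union_disjoint[symmetric])
        (auto simp: near_def far_def intro!: sum.cong intro: finite_subset[of _ "{j..n}"])
    then show ?thesis
      using near far unfolding M_def[symmetric] V_def by (simp add: algebra_simps)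
  qed
qed

lemma forward_fractional_integral:
  fixes w g :: "int \<Rightarrow> real"
  assumes \<alpha>: "0 < \<alpha>" "\<alpha> < 1" and p: "1 < p" "\<alpha> * p < 1" and s: "1 / s = 1 / p - \<alpha>"
    and w: "\<And>i. 0 < w i" and g: "\<And>i. 0 \<le> g i"
    and L: "(\<Sum>i = m..n. g i powr p * w i) \<le> L"
    and \<beta>: "\<beta> = (1 - \<alpha>) * (p / (p - 1))"
  shows "(\<Sum>j = m..n. w j * (\<Sum>i = j..n. sum w {j..i} powr (\<alpha> - 1) * (g i * w i)) powr s)
    \<le> (1 / \<alpha> + \<beta> / (\<beta> - 1) + L) powr s * ((2 * p / (p - 1)) powr p * L)"
proof -
  define B where "B = 1 / \<alpha> + \<beta> / (\<beta> - 1) + L"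
  have L0: "0 \<le> L"
  proof -
    have "0 \<le> (\<Sum>i = m..n. g i powr p * w i)"
      using w by (intro sum_nonneg mult_nonneg_nonneg) (auto intro: less_imp_le)
    then show ?thesis using L by simp
  qed
  have "1 < \<beta>" using p by (simp add: \<beta> field_simps)
  then have B: "0 \<le> B" using \<alpha> L0 by (simp add: B_def)
  have "\<alpha> < 1 / p" using p by (simp add: pos_less_divide_eq)
  then have "0 < 1 / s" using s by simp
  then have s0: "0 < s" by simp
  have "w j * (\<Sum>i = j..n. sum w {j..i} powr (\<alpha> - 1) * (g i * w i)) powr s
      \<le> B powr s * (w j * forward_maximal w g n j powr p)" if j: "j \<in> {m..n}" for j
  proof -
    have "(\<Sum>i = j..n. g i powr p * w i) \<le> (\<Sum>i = m..n. g i powr p * w i)"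
      using w j by (intro sum_mono2) (auto intro!: mult_nonneg_nonneg intro: less_imp_le)
    then have "(\<Sum>i = j..n. sum w {j..i} powr (\<alpha> - 1) * (g i * w i)) \<le> B * forward_maximal w g n j powr (p / s)"
      unfolding B_def using assms j by (intro fractional_integral_pointwise) auto
    moreover have "0 \<le> (\<Sum>i = j..n. sum w {j..i} powr (\<alpha> - 1) * (g i * w i))"
      using g w by (intro sum_nonneg) (auto intro!: mult_nonneg_nonneg intro: less_imp_le)
    ultimately have "(\<Sum>i = j..n. sum w {j..i} powr (\<alpha> - 1) * (g i * w i)) powr s
        \<le> (B * forward_maximal w g n j powr (p / s)) powr s"
      using s0 by (intro powr_mono2) auto
    also have "\<dots> = B powr s * forward_maximal w g n j powr p"
      using B s0 by (simp add: powr_mult powr_powr)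
    finally show ?thesis using w[of j] by (simp add: mult.left_commute mult_left_mono)
  qed
  then have "(\<Sum>j = m..n. w j * (\<Sum>i = j..n. sum w {j..i} powr (\<alpha> - 1) * (g i * w i)) powr s)
      \<le> (\<Sum>j = m..n. B powr s * (w j * forward_maximal w g n j powr p))"
    by (rule sum_mono)
  also have "\<dots> = B powr s * (\<Sum>j = m..n. w j * forward_maximal w g n j powr p)"
    by (simp add: sum_distrib_left)
  also have "\<dots> \<le> B powr s * ((2 * p / (p - 1)) powr p * (\<Sum>i = m..n. g i powr p * w i))"
    using forward_maximal_strong_type[OF p(1) w g] by (intro mult_left_mono) auto
  also have "\<dots> \<le> B powr s * ((2 * p / (p - 1)) powr p * L)"
    using L by (intro mult_left_mono) auto
  finally show ?thesis unfolding B_def .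
qed


section \<open>The Riesz potential with a weight of class \<open>A\<^sub>1\<close>\<close>

lemma sum_reflect:
  fixes f :: "int \<Rightarrow> real"
  shows "(\<Sum>i = a..b. f (- i)) = sum f {- b..- a}"
  by (rule sum.reindex_bij_witness[of _ uminus uminus]) auto

lemma backward_fractional_integral:
  fixes w g :: "int \<Rightarrow> real"
  assumes "0 < \<alpha>" "\<alpha> < 1" "1 < p" "\<alpha> * p < 1" "1 / s = 1 / p - \<alpha>"
    and w: "\<And>i. 0 < w i" and g: "\<And>i. 0 \<le> g i"
    and L: "(\<Sum>i = m..n. g i powr p * w i) \<le> L"
    and "\<beta> = (1 - \<alpha>) * (p / (p - 1))"
  shows "(\<Sum>j = m..n. w j * (\<Sum>i = m..j. sum w {i..j} powr (\<alpha> - 1) * (g i * w i)) powr s)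
    \<le> (1 / \<alpha> + \<beta> / (\<beta> - 1) + L) powr s * ((2 * p / (p - 1)) powr p * L)"
proof -
  have "(\<Sum>j = - n..- m. w (- j) * (\<Sum>i = j..- m. (\<Sum>l = j..i. w (- l)) powr (\<alpha> - 1) * (g (- i) * w (- i))) powr s)
    \<le> (1 / \<alpha> + \<beta> / (\<beta> - 1) + L) powr s * ((2 * p / (p - 1)) powr p * L)"
    using assms sum_reflect[of "\<lambda>i. g i powr p * w i" "- n" "- m"]
    by (intro forward_fractional_integral) auto
  also have "(\<Sum>j = - n..- m. w (- j) * (\<Sum>i = j..- m. (\<Sum>l = j..i. w (- l)) powr (\<alpha> - 1) * (g (- i) * w (- i))) powr s)
      = (\<Sum>j = - n..- m. w (- j) * (\<Sum>i = m..- j. sum w {i..- j} powr (\<alpha> - 1) * (g i * w i)) powr s)"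
    using sum_reflect[of "\<lambda>i. sum w {i..- j} powr (\<alpha> - 1) * (g i * w i)" j "- m" for j]
    by (simp add: sum_reflect)
  also have "\<dots> = (\<Sum>j = m..n. w j * (\<Sum>i = m..j. sum w {i..j} powr (\<alpha> - 1) * (g i * w i)) powr s)"
    by (subst sum_reflect) simp
  finally show ?thesis .
qed

lemma powr_add_le:
  fixes x y s :: real
  assumes "0 \<le> x" "0 \<le> y" "0 \<le> s"
  shows "(x + y) powr s \<le> 2 powr s * (x powr s + y powr s)"
proof -
  have "(x + y) powr s \<le> (2 * max x y) powr s"
    using assms by (intro powr_mono2) auto
  also have "\<dots> = 2 powr s * max x y powr s"
    using assms by (simp add: powr_mult)
  also have "\<dots> \<le> 2 powr s * (x powr s + y powr s)"
    by (intro mult_left_mono) (auto simp: max_def)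
  finally show ?thesis .
qed

text \<open>
  The kernel is decreasing in \<open>\<bar>i - j\<bar>\<close>, and the \<open>A\<^sub>1\<close> condition bounds \<open>\<bar>i - j\<bar> * w i\<close> from below
  by a multiple of the mass between \<open>i\<close> and \<open>j\<close>.  The factor 2 passes from the number
  \<open>\<bar>i - j\<bar> + 1\<close> of points to \<open>\<bar>i - j\<bar>\<close>.
\<close>

lemma riesz_kernel_A1_bound:
  fixes w :: "int \<Rightarrow> real"
  assumes "\<alpha> < 1" and w: "\<And>i. 0 < w i" and "0 < D" and "i \<noteq> j"
    and A1: "sum w {min i j..max i j} \<le> D * (real_of_int \<bar>i - j\<bar> + 1) * w i"
  shows "real_of_int \<bar>i - j\<bar> powr (\<alpha> - 1)
    \<le> (2 * D) powr (1 - \<alpha>) * (sum w {min i j..max i j} powr (\<alpha> - 1) * w i powr (1 - \<alpha>))"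
proof -
  let ?V = "sum w {min i j..max i j}" and ?d = "real_of_int \<bar>i - j\<bar>"
  have d: "1 \<le> ?d" using \<open>i \<noteq> j\<close> by linarith
  have V: "0 < ?V" using w by (intro sum_pos) auto
  have "?V \<le> D * (2 * ?d) * w i"
    using d w[of i] \<open>0 < D\<close>
    by (intro order_trans[OF A1] mult_right_mono mult_left_mono) auto
  then have "?V / (2 * D * w i) \<le> ?d"
    using w[of i] \<open>0 < D\<close> by (simp add: field_simps)
  then have "?d powr (\<alpha> - 1) \<le> (?V / (2 * D * w i)) powr (\<alpha> - 1)"
    using w[of i] \<open>0 < D\<close> V \<open>\<alpha> < 1\<close> by (intro powr_mono2') auto
  also have "\<dots> = (2 * D) powr (1 - \<alpha>) * (?V powr (\<alpha> - 1) * w i powr (1 - \<alpha>))"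
    using w[of i] \<open>0 < D\<close> V powr_minus_divide[of _ "1 - \<alpha>"]
    by (simp add: powr_divide powr_mult)
  finally show ?thesis .
qed

text \<open>
  The diagonal term of the inner sum vanishes, since \<open>0 powr (\<alpha> - 1) = 0\<close>.  The inequality is
  scale invariant, but fixing the bound \<open>L\<close> on the right side suffices here and makes
  \<open>C\<close> depend on \<open>\<alpha>\<close>, \<open>p\<close>, \<open>s\<close>, \<open>D\<close> and \<open>L\<close> only: it is uniform in the weight and in the window.
\<close>

lemma A1_weighted_riesz_bound:
  assumes \<alpha>: "0 < \<alpha>" "\<alpha> < 1" and p: "1 < p" "\<alpha> * p < 1" and s: "1 / s = 1 / p - \<alpha>"
    and "0 < D"
  shows "\<exists>C. \<forall>(w :: int \<Rightarrow> real) a m n. (\<forall>i. 0 < w i) \<longrightarrow> (\<forall>i. 0 \<le> a i) \<longrightarrow>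
    (\<forall>i j. sum w {min i j..max i j} \<le> D * (real_of_int \<bar>i - j\<bar> + 1) * w i) \<longrightarrow>
    (\<Sum>i = m..n. a i powr p * w i powr (p / s)) \<le> L \<longrightarrow>
    (\<Sum>j = m..n. w j * (\<Sum>i = m..n. a i * real_of_int \<bar>i - j\<bar> powr (\<alpha> - 1)) powr s) \<le> C"
proof -
  define \<beta> where "\<beta> = (1 - \<alpha>) * (p / (p - 1))"
  define B where "B = (1 / \<alpha> + \<beta> / (\<beta> - 1) + L) powr s * ((2 * p / (p - 1)) powr p * L)"
  define c where "c = (2 * D) powr (1 - \<alpha>)"
  have "\<alpha> < 1 / p" using p by (simp add: pos_less_divide_eq)
  then have "0 < 1 / s" using s by simp
  then have s0: "0 < s" by simp
  have ps: "p / s = 1 - \<alpha> * p" using p s s0 by (simp add: field_simps)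
  show ?thesis
  proof (intro exI allI impI)
    fix w a :: "int \<Rightarrow> real" and m n :: int
    assume "\<forall>i. 0 < w i" "\<forall>i. 0 \<le> a i"
      and "\<forall>i j. sum w {min i j..max i j} \<le> D * (real_of_int \<bar>i - j\<bar> + 1) * w i"
      and L: "(\<Sum>i = m..n. a i powr p * w i powr (p / s)) \<le> L"
    then have w: "0 < w i" and a: "0 \<le> a i"
      and A1: "sum w {min i j..max i j} \<le> D * (real_of_int \<bar>i - j\<bar> + 1) * w i" for i j
      by blast+
    \<comment> \<open>The substitution that turns the weight \<open>w powr (p / s)\<close> of \<open>a\<close> into \<open>w\<close>, by
      \<open>p / s = 1 - \<alpha> * p\<close>.\<close>
    define g where "g i = a i * w i powr - \<alpha>" for i
    have g: "0 \<le> g i" for i using a by (simp add: g_def)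
    have "g i powr p * w i = a i powr p * w i powr (p / s)" for i
    proof -
      have "g i powr p = a i powr p * w i powr - (\<alpha> * p)"
        using a[of i] by (simp add: g_def powr_mult powr_powr)
      moreover have "w i powr - (\<alpha> * p) * w i = w i powr (p / s)"
        using w[of i] by (simp add: ps powr_mult_base mult.commute)
      ultimately show ?thesis by simp
    qed
    then have gL: "(\<Sum>i = m..n. g i powr p * w i) \<le> L" using L by simp
    define F where "F j = (\<Sum>i = j..n. sum w {j..i} powr (\<alpha> - 1) * (g i * w i))" for j
    define G where "G j = (\<Sum>i = m..j. sum w {i..j} powr (\<alpha> - 1) * (g i * w i))" for j
    define R where "R j = (\<Sum>i = m..n. a i * real_of_int \<bar>i - j\<bar> powr (\<alpha> - 1))" for j
    have gw: "0 \<le> sum w {k..l} powr (\<alpha> - 1) * (g i * w i)" for i k l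
      using g[of i] w[of i] by simp
    have F0: "0 \<le> F j" and G0: "0 \<le> G j" for j
      unfolding F_def G_def by (intro sum_nonneg gw)+
    have R0: "0 \<le> R j" for j unfolding R_def using a by (intro sum_nonneg) auto
    have kernel: "a i * real_of_int \<bar>i - j\<bar> powr (\<alpha> - 1)
        \<le> c * (sum w {min i j..max i j} powr (\<alpha> - 1) * (g i * w i))" if "i \<noteq> j" for i j
    proof -
      have "a i * real_of_int \<bar>i - j\<bar> powr (\<alpha> - 1)
          \<le> a i * (c * (sum w {min i j..max i j} powr (\<alpha> - 1) * w i powr (1 - \<alpha>)))"
        unfolding c_def using a[of i] that \<alpha>(2) w \<open>0 < D\<close> A1
        by (intro mult_left_mono riesz_kernel_A1_bound) auto
      also have "a i * w i powr (1 - \<alpha>) = g i * w i"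
        using w[of i] by (simp add: g_def powr_diff powr_minus field_simps)
      then have "a i * (c * (sum w {min i j..max i j} powr (\<alpha> - 1) * w i powr (1 - \<alpha>)))
          = c * (sum w {min i j..max i j} powr (\<alpha> - 1) * (g i * w i))"
        by (simp add: algebra_simps)
      finally show ?thesis .
    qed
    have RFG: "R j \<le> c * (F j + G j)" if j: "j \<in> {m..n}" for j
    proof -
      have "R j = (\<Sum>i\<in>{m..n} - {j}. a i * real_of_int \<bar>i - j\<bar> powr (\<alpha> - 1))"
        unfolding R_def by (rule sum.mono_neutral_right) auto
      also have "\<dots> \<le> (\<Sum>i\<in>{m..n} - {j}. c * (sum w {min i j..max i j} powr (\<alpha> - 1) * (g i * w i)))"
        by (intro sum_mono kernel) auto
      also have "{m..n} - {j} = {j<..n} \<union> {m..<j}" using j by auto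
      also have "(\<Sum>i\<in>{j<..n} \<union> {m..<j}. c * (sum w {min i j..max i j} powr (\<alpha> - 1) * (g i * w i)))
          = c * ((\<Sum>i\<in>{j<..n}. sum w {j..i} powr (\<alpha> - 1) * (g i * w i))
            + (\<Sum>i\<in>{m..<j}. sum w {i..j} powr (\<alpha> - 1) * (g i * w i)))"
        unfolding distrib_left sum_distrib_left
        by (subst sum.union_disjoint) (auto intro!: arg_cong2[where f = "(+)"] sum.cong simp: min_def max_def)
      also have "\<dots> \<le> c * (F j + G j)"
        unfolding F_def G_def c_def by (intro mult_left_mono add_mono sum_mono2 gw) auto
      finally show ?thesis .
    qed
    have "w j * R j powr s \<le> (2 * c) powr s * (w j * F j powr s + w j * G j powr s)" if j: "j \<in> {m..n}" for j
    proof -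
      have "R j powr s \<le> (c * (F j + G j)) powr s"
        using RFG[OF j] R0 s0 by (intro powr_mono2) auto
      also have "\<dots> = c powr s * (F j + G j) powr s"
        using F0[of j] G0[of j] by (simp add: powr_mult c_def)
      also have "\<dots> \<le> c powr s * (2 powr s * (F j powr s + G j powr s))"
        using F0 G0 s0 by (intro mult_left_mono powr_add_le) auto
      also have "\<dots> = (2 * c) powr s * (F j powr s + G j powr s)"
        by (simp add: powr_mult c_def)
      finally have "w j * R j powr s \<le> w j * ((2 * c) powr s * (F j powr s + G j powr s))"
        using w[of j] by (intro mult_left_mono) auto
      then show ?thesis by (simp add: algebra_simps)
    qed
    then have "(\<Sum>j = m..n. w j * R j powr s)
        \<le> (\<Sum>j = m..n. (2 * c) powr s * (w j * F j powr s + w j * G j powr s))"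
      by (rule sum_mono)
    also have "\<dots> = (2 * c) powr s * ((\<Sum>j = m..n. w j * F j powr s) + (\<Sum>j = m..n. w j * G j powr s))"
      by (simp add: sum.distrib sum_distrib_left distrib_left)
    also have "\<dots> \<le> (2 * c) powr s * (B + B)"
      unfolding F_def G_def B_def using \<alpha> p s w g gL \<beta>_def
      by (intro mult_left_mono add_mono forward_fractional_integral backward_fractional_integral) auto
    finally show "(\<Sum>j = m..n. w j * (\<Sum>i = m..n. a i * real_of_int \<bar>i - j\<bar> powr (\<alpha> - 1)) powr s)
        \<le> (2 * c) powr s * (B + B)"
      unfolding R_def .
  qed
qed


section \<open>The Rubio de Francia weight\<close>

lemma infsum_ennreal_le_1_iff:
  fixes f :: "'a \<Rightarrow> real"
  assumes "\<And>i. 0 \<le> f i"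
  shows "(\<Sum>\<^sub>\<infinity>i. ennreal (f i)) \<le> 1 \<longleftrightarrow> (\<forall>F. finite F \<longrightarrow> sum f F \<le> 1)"
proof -
  have "sum (\<lambda>i. ennreal (f i)) F \<le> 1 \<longleftrightarrow> sum f F \<le> 1" for F
    using assms by (simp add: ennreal_le_1)
  moreover have "(\<Sum>\<^sub>\<infinity>i. ennreal (f i)) \<le> 1 \<longleftrightarrow> (\<forall>F. finite F \<longrightarrow> sum (\<lambda>i. ennreal (f i)) F \<le> 1)"
    by (subst nonneg_infsum_complete) (auto simp: SUP_le_iff)
  ultimately show ?thesis by simp
qed

lemma vlp_norm_leI:
  assumes "0 < t" "\<And>F. finite F \<Longrightarrow> (\<Sum>i\<in>F. (cmod (a i) / t) powr p i) \<le> 1"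
  shows "vlp_norm p a \<le> ennreal t"
  unfolding vlp_norm_def using assms
  by (intro Inf_lower imageI) (simp add: infsum_ennreal_le_1_iff norm_divide)

lemma vlp_norm_lessD:
  assumes "vlp_norm p a < ennreal t" "\<And>i. 0 \<le> p i" "finite F"
  shows "(\<Sum>i\<in>F. (cmod (a i) / t) powr p i) \<le> 1"
proof -
  obtain u where u: "0 < u" "u < t" "(\<Sum>\<^sub>\<infinity>i. ennreal (cmod (a i / complex_of_real u) powr p i)) \<le> 1"
    using assms(1) unfolding vlp_norm_def Inf_less_iff by (auto simp: ennreal_less_iff)
  have "(\<Sum>i\<in>F. (cmod (a i) / t) powr p i) \<le> (\<Sum>i\<in>F. (cmod (a i) / u) powr p i)"
    using u assms(2) by (intro sum_mono powr_mono2 divide_left_mono) auto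
  also have "\<dots> \<le> 1"
    using u assms(3) by (simp add: infsum_ennreal_le_1_iff norm_divide)
  finally show ?thesis .
qed

lemma average_le_discrete_maximal:
  assumes "\<And>i. 1 \<le> p i" "a \<in> vlp_space p" "m \<le> j" "j \<le> n"
  shows "(\<Sum>i = m..n. cmod (a i)) \<le> real_of_int (n - m + 1) * cmod (discrete_maximal a j)"
proof -
  let ?S = "SUP (m, n) \<in> {(m, n). m \<le> j \<and> j \<le> n}.
       1 / real_of_int (n - m + 1) * (\<Sum>i = m..n. cmod (a i))"
  have "1 / real_of_int (n - m + 1) * (\<Sum>i = m..n. cmod (a i)) \<le> ?S"
    using cSUP_upper[OF _ bdd_above_averages[OF assms(1,2)], of "(m, n)" j] assms(3,4) by simp
  also have "\<dots> \<le> cmod (discrete_maximal a j)" by (simp add: discrete_maximal_def)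
  finally show ?thesis using assms(3,4) by (simp add: field_simps)
qed

text \<open>
  Young's inequality in the form that \<open>x powr r\<close> lies above its tangent at \<open>y\<close>.  Summed against
  any probability weights with mean \<open>y\<close>, also infinitely many, it becomes Jensen's inequality.
\<close>

lemma powr_tangent_le:
  fixes x y r :: real
  assumes "1 \<le> r" "0 \<le> x" "0 \<le> y"
  shows "y powr r + r * y powr (r - 1) * (x - y) \<le> x powr r"
proof (cases "r = 1 \<or> y = 0")
  case True
  then show ?thesis using assms by auto
next
  case False
  then have r: "1 < r" and y: "0 < y" using assms by auto
  have "x * y powr (r - 1) \<le> x powr r / r + (y powr (r - 1)) powr (r / (r - 1)) / (r / (r - 1))"
    using r assms by (intro Youngs_inequality) (auto simp: field_simps)
  also have "(y powr (r - 1)) powr (r / (r - 1)) = y powr r"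
    using r by (simp add: powr_powr)
  finally have "r * (x * y powr (r - 1)) \<le> r * (x powr r / r + y powr r / (r / (r - 1)))"
    using r by (intro mult_left_mono) auto
  also have "\<dots> = x powr r + (r - 1) * y powr r" using r by (simp add: field_simps)
  finally have "r * (x * y powr (r - 1)) \<le> x powr r + (r - 1) * y powr r" .
  moreover have "y powr (r - 1) * y = y powr r" using y by (simp add: powr_mult_base mult.commute)
  ultimately show ?thesis by (simp add: algebra_simps)
qed

lemma summable_dyadic_average:
  fixes u :: "nat \<Rightarrow> real"
  assumes "\<And>k. 0 \<le> u k" "\<And>k. u k \<le> 1"
  shows "summable (\<lambda>k. (1 / 2) ^ Suc k * u k)"
  using assms by (intro summable_comparison_test'[OF sums_summable[OF power_half_series], where N = 0])
    (auto intro: mult_left_le)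

lemma powr_dyadic_average_le:
  fixes x :: "nat \<Rightarrow> real"
  assumes "1 \<le> r" and x: "\<And>k. 0 \<le> x k" "\<And>k. x k \<le> 1"
  shows "(\<Sum>k. (1 / 2) ^ Suc k * x k) powr r \<le> (\<Sum>k. (1 / 2) ^ Suc k * x k powr r)"
proof -
  define y where "y = (\<Sum>k. (1 / 2) ^ Suc k * x k)"
  have xr: "x k powr r \<le> 1" for k using x[of k] \<open>1 \<le> r\<close> by (intro powr_le1) auto
  have y0: "0 \<le> y" unfolding y_def using x summable_dyadic_average[OF x] by (intro suminf_nonneg) auto
  have sx: "(\<lambda>k. (1 / 2) ^ Suc k * x k) sums y"
    unfolding y_def using summable_dyadic_average[OF x] by (rule summable_sums)
  have "(\<lambda>k. (1 / 2) ^ Suc k * (y powr r - r * y powr (r - 1) * y) + r * y powr (r - 1) * ((1 / 2) ^ Suc k * x k))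
      sums (1 * (y powr r - r * y powr (r - 1) * y) + r * y powr (r - 1) * y)"
    by (intro sums_add sums_mult sums_mult2 sx power_half_series)
  then have "(\<lambda>k. (1 / 2) ^ Suc k * (y powr r + r * y powr (r - 1) * (x k - y))) sums (y powr r)"
    by (simp add: algebra_simps)
  moreover have "(\<lambda>k. (1 / 2) ^ Suc k * x k powr r) sums (\<Sum>k. (1 / 2) ^ Suc k * x k powr r)"
    using summable_dyadic_average[OF _ xr] by (intro summable_sums) auto
  ultimately have "y powr r \<le> (\<Sum>k. (1 / 2) ^ Suc k * x k powr r)"
    using powr_tangent_le[OF \<open>1 \<le> r\<close> x(1) y0] by (elim sums_le[rotated]) (auto intro: mult_left_mono)
  then show ?thesis unfolding y_def .
qed

text \<open>
  The weight is \<open>\<Sum>\<^sub>k 2\<^bsup>-k-1\<^esup> M\<^sup>k h / (K + 1)\<^sup>k\<close>.  Every term has modular at most 1, hence so has this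
  convex combination.  Since \<open>M\<close> shifts the series by one place, the interval averages of \<open>w\<close> are
  at most \<open>2 * (K + 1) * w\<close>.  The iterates are divided by \<open>K + 1\<close> instead of \<open>K\<close>
  because a norm strictly below 1 bounds the modular by 1 directly from the definition as an
  infimum, and because \<open>K\<close> may be 0.
\<close>

lemma rubio_de_francia_weight:
  fixes r h :: "int \<Rightarrow> real"
  assumes r: "\<And>i. 1 \<le> r i" and "0 \<le> K"
    and bdd: "\<And>a. a \<in> vlp_space r \<Longrightarrow> vlp_norm r (discrete_maximal a) \<le> ennreal K * vlp_norm r a"
    and h: "\<And>i. 0 \<le> h i" "\<And>F. finite F \<Longrightarrow> (\<Sum>i\<in>F. h i powr r i) \<le> 1"
  obtains w where "\<And>i. h i \<le> 2 * w i" "\<And>i. 0 \<le> w i"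
    "\<And>F. finite F \<Longrightarrow> (\<Sum>i\<in>F. w i powr r i) \<le> 1"
    "\<And>i j. sum w {min i j..max i j} \<le> 2 * (K + 1) * (real_of_int \<bar>i - j\<bar> + 1) * w i"
proof -
  define H where "H = rec_nat (\<lambda>i. complex_of_real (h i))
    (\<lambda>_ a i. discrete_maximal a i / complex_of_real (K + 1))"
  have H0: "H 0 = (\<lambda>i. complex_of_real (h i))"
    and H_Suc: "H (Suc k) = (\<lambda>i. discrete_maximal (H k) i / complex_of_real (K + 1))" for k
    by (simp_all add: H_def)
  have norm_H_Suc: "cmod (H (Suc k) i) = cmod (discrete_maximal (H k) i) / (K + 1)" for k i
    unfolding H_Suc norm_divide norm_of_real using \<open>0 \<le> K\<close> by simp
  define x where "x k i = cmod (H k i)" for k i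
  have xnn: "0 \<le> x k i" for k i by (simp add: x_def)
  have norm_le: "vlp_norm r (H k) \<le> 1" if "\<And>F. finite F \<Longrightarrow> (\<Sum>i\<in>F. x k i powr r i) \<le> 1" for k
    using vlp_norm_leI[of 1 "H k" r] that by (simp add: x_def)
  have space: "H k \<in> vlp_space r" if "vlp_norm r (H k) \<le> 1" for k
    using that by (simp add: vlp_space_def) (metis ennreal_one_less_top order_le_less_trans)
  have mod: "(\<Sum>i\<in>F. x k i powr r i) \<le> 1" if "finite F" for k F
    using that
  proof (induction k arbitrary: F)
    case 0
    then show ?case using h by (simp add: x_def H0)
  next
    case (Suc k)
    have le1: "vlp_norm r (H k) \<le> 1" using Suc.IH by (rule norm_le)
    have "vlp_norm r (discrete_maximal (H k)) \<le> ennreal K * vlp_norm r (H k)"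
      using bdd space[OF le1] by blast
    also have "\<dots> \<le> ennreal K * 1" using le1 by (intro mult_left_mono) auto
    also have "\<dots> < ennreal (K + 1)" using \<open>0 \<le> K\<close> by (simp add: ennreal_less_iff)
    finally have "(\<Sum>i\<in>F. (cmod (discrete_maximal (H k) i) / (K + 1)) powr r i) \<le> 1"
      using r Suc.prems by (intro vlp_norm_lessD) (auto intro: order_trans[OF zero_le_one])
    then show ?case by (simp add: x_def norm_H_Suc)
  qed
  have x1: "x k i \<le> 1" for k i
  proof (rule powr_le_1_D)
    show "x k i powr r i \<le> 1" using mod[of "{i}" k] by simp
  qed (use xnn r[of i] in auto)
  have A1: "(\<Sum>l = min i j..max i j. x k l) \<le> (K + 1) * (real_of_int \<bar>i - j\<bar> + 1) * x (Suc k) i" for i j k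
  proof -
    have "(\<Sum>l = min i j..max i j. cmod (H k l))
        \<le> real_of_int (max i j - min i j + 1) * cmod (discrete_maximal (H k) i)"
      using r space norm_le mod by (intro average_le_discrete_maximal[of r]) auto
    also have "real_of_int (max i j - min i j + 1) = real_of_int \<bar>i - j\<bar> + 1" by (simp add: max_def min_def)
    also have "cmod (discrete_maximal (H k) i) = (K + 1) * x (Suc k) i"
      using \<open>0 \<le> K\<close> by (simp add: x_def norm_H_Suc)
    finally show ?thesis by (simp add: x_def mult_ac)
  qed
  have sx: "summable (\<lambda>k. (1 / 2) ^ Suc k * x k i)" for i using xnn x1 by (rule summable_dyadic_average)
  define w where "w i = (\<Sum>k. (1 / 2) ^ Suc k * x k i)" for i
  have tail: "w i = x 0 i / 2 + (\<Sum>k. (1 / 2) ^ Suc (Suc k) * x (Suc k) i)" for i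
    unfolding w_def using suminf_split_head[OF sx[of i]] by simp
  have tail_nn: "0 \<le> (\<Sum>k. (1 / 2) ^ Suc (Suc k) * x (Suc k) i)" for i
    using xnn sx[of i] summable_Suc_iff[of "\<lambda>k. (1 / 2) ^ Suc k * x k i"] by (intro suminf_nonneg) auto
  show thesis
  proof (rule that)
    show "0 \<le> w i" for i unfolding w_def using xnn sx by (intro suminf_nonneg) auto
    show "h i \<le> 2 * w i" for i
      using tail[of i] tail_nn[of i] h(1)[of i] by (simp add: x_def H0)
    show "(\<Sum>i\<in>F. w i powr r i) \<le> 1" if "finite F" for F
    proof -
      have xr: "0 \<le> x k i powr r i" "x k i powr r i \<le> 1" for k i
        using xnn[of k i] x1[of k i] r[of i] by (auto intro!: powr_le1)
      have "(\<Sum>i\<in>F. w i powr r i) \<le> (\<Sum>i\<in>F. \<Sum>k. (1 / 2) ^ Suc k * x k i powr r i)"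
        unfolding w_def by (intro sum_mono powr_dyadic_average_le r xnn x1)
      also have "\<dots> = (\<Sum>k. \<Sum>i\<in>F. (1 / 2) ^ Suc k * x k i powr r i)"
        by (intro suminf_sum[symmetric] summable_dyadic_average xr)
      also have "\<dots> = (\<Sum>k. (1 / 2) ^ Suc k * (\<Sum>i\<in>F. x k i powr r i))"
        by (simp add: sum_distrib_left)
      also have "\<dots> \<le> (\<Sum>k. (1 / 2) ^ Suc k)"
        using mod[OF that] xr power_half_series
        by (intro suminf_le summable_dyadic_average sums_summable[OF power_half_series]) (auto intro: mult_left_le sum_nonneg)
      also have "\<dots> = 1" using power_half_series by (rule sums_unique[symmetric])
      finally show ?thesis .
    qed
    show "sum w {min i j..max i j} \<le> 2 * (K + 1) * (real_of_int \<bar>i - j\<bar> + 1) * w i" for i j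
    proof -
      let ?I = "{min i j..max i j}" and ?c = "2 * (K + 1) * (real_of_int \<bar>i - j\<bar> + 1)"
      have s2: "summable (\<lambda>k. (1 / 2) ^ Suc (Suc k) * x (Suc k) i)"
        using sx[of i] summable_Suc_iff[of "\<lambda>k. (1 / 2) ^ Suc k * x k i"] by simp
      have "sum w ?I = (\<Sum>k. \<Sum>l\<in>?I. (1 / 2) ^ Suc k * x k l)"
        unfolding w_def by (intro suminf_sum[symmetric] sx)
      also have "\<dots> \<le> (\<Sum>k. ?c * ((1 / 2) ^ Suc (Suc k) * x (Suc k) i))"
      proof (intro suminf_le summable_sum sx summable_mult s2)
        fix k
        have "(\<Sum>l\<in>?I. (1 / 2) ^ Suc k * x k l) = (1 / 2) ^ Suc k * (\<Sum>l\<in>?I. x k l)"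
          by (simp add: sum_distrib_left)
        also have "\<dots> \<le> (1 / 2) ^ Suc k * ((K + 1) * (real_of_int \<bar>i - j\<bar> + 1) * x (Suc k) i)"
          by (intro mult_left_mono A1) auto
        also have "\<dots> = ?c * ((1 / 2) ^ Suc (Suc k) * x (Suc k) i)" by simp
        finally show "(\<Sum>l\<in>?I. (1 / 2) ^ Suc k * x k l) \<le> ?c * ((1 / 2) ^ Suc (Suc k) * x (Suc k) i)" .
      qed
      also have "\<dots> = ?c * (\<Sum>k. (1 / 2) ^ Suc (Suc k) * x (Suc k) i)"
        using s2 by (rule suminf_mult)
      also have "\<dots> \<le> ?c * w i"
        using tail[of i] xnn[of 0 i] \<open>0 \<le> K\<close> by (intro mult_left_mono) auto
      finally show ?thesis .
    qed
  qed
qed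


lemma weighted_young_powr:
  fixes u v \<theta> a b :: real
  assumes "0 \<le> u" "0 \<le> v" "0 \<le> a" "0 \<le> b" "a + b = 1"
  shows "u powr a * v powr b \<le> a * u + b * v"
proof (cases "u = 0 \<or> v = 0")
  case True
  then show ?thesis using assms by auto
next
  case False
  then show ?thesis using assms by (intro Youngs_inequality_0) auto
qed

section \<open>Extrapolation\<close>

text \<open>
  The extrapolation argument, with a constant \<open>T\<close> that depends neither on the sequence nor on the
  window.
\<close>

lemma riesz_window_modular_bound:
  fixes p q :: "int \<Rightarrow> real"
  assumes \<alpha>: "0 < \<alpha>" "\<alpha> < 1" and s: "1 / (1 - \<alpha>) < s" and q: "\<And>i. s < q i"
    and B: "conjugate_exponent (\<lambda>i. q i / s) \<in> exponents_B"
    and pq: "\<And>i. 1 / p i = 1 / q i + \<alpha>"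
  shows "\<exists>T>0. \<forall>a m n. (\<forall>i. 0 \<le> a i) \<longrightarrow> (\<forall>F. finite F \<longrightarrow> (\<Sum>i\<in>F. a i powr p i) \<le> 1) \<longrightarrow>
    (\<Sum>j = m..n. ((\<Sum>i = m..n. a i * real_of_int \<bar>i - j\<bar> powr (\<alpha> - 1)) / T) powr q j) \<le> 1"
proof -
  define r where "r = conjugate_exponent (\<lambda>i. q i / s)"
  have s1: "1 < s * (1 - \<alpha>)" and s0: "0 < s"
  proof -
    show "1 < s * (1 - \<alpha>)" using s \<alpha> by (simp add: pos_divide_less_eq)
    show "0 < s" using s \<alpha> by (meson divide_pos_pos diff_gt_0_iff_gt less_trans zero_less_one)
  qed
  have q0: "0 < q i" for i using q[of i] s0 by simp
  have rinv: "1 / r i = 1 - s / q i" for i by (simp add: r_def conjugate_exponent_def)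
  have r1: "1 \<le> r i" for i
    using B by (simp add: r_def exponents_B_def exponents_P_def)
  obtain K where K: "0 \<le> K"
    and bdd: "\<And>a. a \<in> vlp_space r \<Longrightarrow> vlp_norm r (discrete_maximal a) \<le> ennreal K * vlp_norm r a"
    using B unfolding r_def exponents_B_def by blast
  \<comment> \<open>The constant exponent that \<open>I\<^sub>\<alpha>\<close> pairs with \<open>s\<close>.\<close>
  define p0 where "p0 = s / (1 + \<alpha> * s)"
  have d: "0 < 1 + \<alpha> * s" using \<alpha> s0 by (simp add: add_pos_pos)
  have p0: "1 < p0" "\<alpha> * p0 < 1" "1 / s = 1 / p0 - \<alpha>" "0 < p0"
    using d s0 s1 \<alpha> by (auto simp: p0_def field_simps)
  have p_pos: "0 < p i" for i
  proof -
    have "0 < 1 / p i" using pq[of i] q0[of i] \<alpha> by (simp add: add_pos_pos)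
    then show ?thesis by simp
  qed
  \<comment> \<open>The conjugate exponent of \<open>p i / p0\<close> is \<open>s * r i / p0\<close>.\<close>
  have conj: "p0 / p i + p0 / s / r i = 1" for i
  proof -
    have "p0 / s / r i = p0 / s * (1 / r i)" by simp
    also have "\<dots> = p0 / s - p0 / q i"
      unfolding rinv using s0 by (simp add: right_diff_distrib)
    finally have "p0 / s / r i = p0 / s - p0 / q i" .
    moreover have "p0 / q i = p0 / p i - p0 * \<alpha>"
      using arg_cong[OF pq[of i], of "(*) p0"] by (simp add: distrib_left)
    moreover have "p0 / s = 1 - p0 * \<alpha>"
      using arg_cong[OF p0(3), of "(*) p0"] p0(4) by (simp add: right_diff_distrib)
    ultimately show ?thesis by linarith
  qed
  define D where "D = 2 * (K + 1)"
  have D: "0 < D" using K by (simp add: D_def)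
  obtain C where C: "\<And>(w :: int \<Rightarrow> real) a m n. (\<And>i. 0 < w i) \<Longrightarrow> (\<And>i. 0 \<le> a i) \<Longrightarrow>
      (\<And>i j. sum w {min i j..max i j} \<le> D * (real_of_int \<bar>i - j\<bar> + 1) * w i) \<Longrightarrow>
      (\<Sum>i = m..n. a i powr p0 * w i powr (p0 / s)) \<le> 2 \<Longrightarrow>
      (\<Sum>j = m..n. w j * (\<Sum>i = m..n. a i * real_of_int \<bar>i - j\<bar> powr (\<alpha> - 1)) powr s) \<le> C"
    using A1_weighted_riesz_bound[OF \<alpha> p0(1-3) D, of 2] by blast
  \<comment> \<open>Any \<open>T\<close> with \<open>T powr s > 2 * C\<close> serves, also when \<open>C\<close> is negative.\<close>
  define T where "T = (2 * \<bar>C\<bar> + 1) powr (1 / s)"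
  have T: "0 < T" "T powr s = 2 * \<bar>C\<bar> + 1"
    using s0 by (auto simp: T_def powr_powr)
  show ?thesis
  proof (intro exI[of _ T] conjI allI impI T(1))
    fix a :: "int \<Rightarrow> real" and m n :: int
    assume a: "\<forall>i. 0 \<le> a i" and a1: "\<forall>F. finite F \<longrightarrow> (\<Sum>i\<in>F. a i powr p i) \<le> 1"
    define R where "R j = (\<Sum>i = m..n. a i * real_of_int \<bar>i - j\<bar> powr (\<alpha> - 1))" for j
    have R0: "0 \<le> R j" for j unfolding R_def using a by (intro sum_nonneg) auto
    define b where "b j = R j / T" for j
    have b0: "0 \<le> b j" for j using R0 T by (simp add: b_def)
    define S where "S = (\<Sum>j = m..n. b j powr q j)"
    have "S \<le> 1"
    proof (rule ccontr)
      assume "\<not> S \<le> 1"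
      then have S: "1 < S" by simp
      \<comment> \<open>The extremiser of the duality between \<open>q / s\<close> and \<open>r\<close>, divided so as to have modular 1.
        As \<open>S > 1\<close> and \<open>1 / r j \<le> 1\<close>, the division costs at most a factor \<open>S\<close> in the pairing.\<close>
      define h where "h j = (if j \<in> {m..n} then b j powr (q j - s) * S powr - (1 / r j) else 0)" for j
      have qs: "(q j - s) * r j = q j" for j
      proof -
        have "q j - s = q j * (1 / r j)"
          unfolding rinv using q0[of j] by (simp add: right_diff_distrib)
        then show ?thesis using r1[of j] by simp
      qed
      have h0: "0 \<le> h j" for j by (simp add: h_def)
      have hr: "h j powr r j = (if j \<in> {m..n} then b j powr q j / S else 0)" for j
      proof -
        have "(S powr - (1 / r j)) powr r j = 1 / S"
          using r1[of j] S by (simp add: powr_powr powr_neg_one)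
        moreover have "(b j powr (q j - s)) powr r j = b j powr q j"
          by (simp add: powr_powr qs)
        ultimately show ?thesis by (simp add: h_def powr_mult)
      qed
      have h_mod: "(\<Sum>j\<in>F. h j powr r j) \<le> 1" if "finite F" for F
      proof -
        have "(\<Sum>j\<in>F. h j powr r j) = (\<Sum>j\<in>F \<inter> {m..n}. b j powr q j / S)"
          unfolding hr using that by (simp add: sum.inter_restrict)
        also have "\<dots> \<le> (\<Sum>j = m..n. b j powr q j / S)"
          using S by (intro sum_mono2) auto
        also have "\<dots> = 1" unfolding sum_divide_distrib[symmetric] S_def[symmetric] using S by simp
        finally show ?thesis .
      qed
      have pairing: "1 \<le> (\<Sum>j = m..n. b j powr s * h j)"
      proof -
        have "1 = (\<Sum>j = m..n. b j powr q j * S powr - 1)"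
          unfolding sum_distrib_right[symmetric] S_def[symmetric] using S by (simp add: powr_neg_one)
        also have "\<dots> \<le> (\<Sum>j = m..n. b j powr q j * S powr - (1 / r j))"
        proof (intro sum_mono mult_left_mono powr_mono)
          show "- 1 \<le> - (1 / r j)" for j using r1[of j] by (simp add: divide_simps)
        qed (use S in auto)
        also have "\<dots> = (\<Sum>j = m..n. b j powr s * h j)"
          by (intro sum.cong) (auto simp: h_def mult.assoc[symmetric] simp flip: powr_add)
        finally show ?thesis .
      qed
      obtain w where w: "\<And>i. h i \<le> 2 * w i" "\<And>i. 0 \<le> w i"
        and w_mod: "\<And>F. finite F \<Longrightarrow> (\<Sum>i\<in>F. w i powr r i) \<le> 1"
        and A1: "\<And>i j. sum w {min i j..max i j} \<le> D * (real_of_int \<bar>i - j\<bar> + 1) * w i"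
        unfolding D_def using rubio_de_francia_weight[of r K h] r1 K bdd h0 h_mod by blast
      obtain k where "0 < h k"
      proof -
        have "\<exists>k. h k \<noteq> 0"
        proof (rule ccontr)
          assume "\<nexists>k. h k \<noteq> 0"
          then show False using pairing by simp
        qed
        then show thesis using that h0 by (metis less_eq_real_def)
      qed
      then have wk: "0 < w k" using w(1)[of k] by simp
      \<comment> \<open>An \<open>A\<^sub>1\<close> weight that is positive at one point is positive everywhere.\<close>
      have w_pos: "0 < w i" for i
      proof -
        have "w k \<le> sum w {min i k..max i k}" using w(2) by (intro member_le_sum) auto
        then have "0 < D * (real_of_int \<bar>i - k\<bar> + 1) * w i" using A1[of i k] wk by simp
        then show ?thesis using w(2)[of i] by (metis less_eq_real_def mult_zero_right less_irrefl)
      qed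
      have "(\<Sum>i = m..n. a i powr p0 * w i powr (p0 / s)) \<le> (\<Sum>i = m..n. a i powr p i + w i powr r i)"
      proof (rule sum_mono)
        fix i
        have "0 < r i" using r1[of i] by simp
        have nn: "0 \<le> p0 / p i" "0 \<le> p0 / s / r i"
          using p0(4) p_pos[of i] s0 \<open>0 < r i\<close> by auto
        have le: "p0 / p i \<le> 1" "p0 / s / r i \<le> 1" using nn conj[of i] by linarith+
        have "a i powr p0 * w i powr (p0 / s) = (a i powr p i) powr (p0 / p i) * (w i powr r i) powr (p0 / s / r i)"
          using p_pos[of i] \<open>0 < r i\<close> by (simp add: powr_powr)
        also have "\<dots> \<le> p0 / p i * a i powr p i + p0 / s / r i * w i powr r i"
          using nn conj[of i] by (intro weighted_young_powr) auto
        also have "\<dots> \<le> 1 * a i powr p i + 1 * w i powr r i"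
          using le by (intro add_mono mult_right_mono) auto
        finally show "a i powr p0 * w i powr (p0 / s) \<le> a i powr p i + w i powr r i" by simp
      qed
      also have "\<dots> \<le> 2"
        using a1 w_mod[of "{m..n}"] by (simp add: sum.distrib) (metis add_mono finite_atLeastAtMost_int one_add_one)
      finally have "(\<Sum>j = m..n. w j * R j powr s) \<le> C"
        unfolding R_def using w_pos a A1 by (intro C) auto
      have "1 \<le> (\<Sum>j = m..n. b j powr s * h j)" by (rule pairing)
      also have "\<dots> \<le> (\<Sum>j = m..n. b j powr s * (2 * w j))"
        using w by (intro sum_mono mult_left_mono) auto
      also have "\<dots> = 2 * (\<Sum>j = m..n. w j * R j powr s) / T powr s"
        using T(1) R0 by (simp add: b_def powr_divide sum_distrib_left sum_divide_distrib mult_ac)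
      also have "\<dots> \<le> 2 * C / (2 * \<bar>C\<bar> + 1)"
        unfolding T(2) using \<open>(\<Sum>j = m..n. w j * R j powr s) \<le> C\<close> by (intro divide_right_mono) auto
      also have "\<dots> < 1" by (simp add: pos_divide_less_eq)
      finally show False by simp
    qed
    then show "(\<Sum>j = m..n. ((\<Sum>i = m..n. a i * real_of_int \<bar>i - j\<bar> powr (\<alpha> - 1)) / T) powr q j) \<le> 1"
      by (simp add: S_def b_def R_def)
  qed
qed

text \<open>
  From windows to the whole line.  The window bounds applied at a single point \<open>j\<close> also bound all
  partial sums of the series for \<open>I\<^sub>\<alpha> a\<close> at \<open>j\<close>, which therefore converges absolutely.
\<close>

lemma riesz_potential_modular_bound:
  fixes p q :: "int \<Rightarrow> real"
  assumes \<alpha>: "\<alpha> < 1" and q: "\<And>i. 0 < q i" and "0 < T" "0 < t"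
    and window: "\<And>m n. (\<Sum>j = m..n. ((\<Sum>i = m..n. (cmod (a i) / t) * real_of_int \<bar>i - j\<bar> powr (\<alpha> - 1)) / T) powr q j) \<le> 1"
    and "finite F"
  shows "(\<Sum>j\<in>F. (cmod (riesz_potential \<alpha> a j) / (T * t)) powr q j) \<le> 1"
proof -
  define f where "f j i = cmod (a i) * real_of_int \<bar>i - j\<bar> powr (\<alpha> - 1)" for i j :: int
  have f0: "0 \<le> f j i" for i j by (simp add: f_def)
  have finite_bound: "(\<Sum>j\<in>G. (sum (f j) E / (T * t)) powr q j) \<le> 1" if "finite E" "finite G" for E G :: "int set"
  proof -
    define m where "m = Min (insert 0 (E \<union> G))"
    define n where "n = Max (insert 0 (E \<union> G))"
    have sub: "E \<subseteq> {m..n}" "G \<subseteq> {m..n}"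
      using that by (auto simp: m_def n_def)
    have "(\<Sum>j\<in>G. (sum (f j) E / (T * t)) powr q j) \<le> (\<Sum>j\<in>G. (sum (f j) {m..n} / (T * t)) powr q j)"
      using sub f0 q \<open>0 < T\<close> \<open>0 < t\<close>
      by (intro sum_mono powr_mono2 divide_right_mono sum_mono2 divide_nonneg_nonneg sum_nonneg)
        (auto intro: less_imp_le)
    also have "\<dots> \<le> (\<Sum>j = m..n. (sum (f j) {m..n} / (T * t)) powr q j)"
      using sub by (intro sum_mono2) auto
    also have "\<dots> \<le> 1"
      using window[of m n] by (simp add: f_def sum_divide_distrib mult.commute)
    finally show ?thesis .
  qed
  have term_bound: "sum (f j) E \<le> T * t" if "finite E" for E j
  proof -
    have "(sum (f j) E / (T * t)) powr q j \<le> 1" using finite_bound[OF that, of "{j}"] by simp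
    then have "sum (f j) E / (T * t) \<le> 1"
      using q[of j] f0 \<open>0 < T\<close> \<open>0 < t\<close>
      by (elim powr_le_1_D) (simp_all add: sum_nonneg)
    then show ?thesis using \<open>0 < T\<close> \<open>0 < t\<close> by (simp add: divide_le_eq)
  qed
  have summ: "f j summable_on UNIV" for j
    by (rule nonneg_bdd_above_summable_on) (auto intro!: bdd_aboveI2[where M = "T * t"] f0 term_bound)
  have norm_le: "cmod (riesz_potential \<alpha> a j) \<le> infsum (f j) UNIV" for j
  proof -
    have norm_eq: "cmod (a i / complex_of_real (real_of_int \<bar>i - j\<bar> powr (1 - \<alpha>))) = f j i" for i
      using powr_minus_divide[of "real_of_int \<bar>i - j\<bar>" "1 - \<alpha>"] by (simp add: f_def norm_divide)
    have s: "f j summable_on {i. i \<noteq> j}"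
      using summ by (rule summable_on_subset_banach) auto
    have "cmod (riesz_potential \<alpha> a j)
        \<le> (\<Sum>\<^sub>\<infinity>i\<in>{i. i \<noteq> j}. cmod (a i / complex_of_real (real_of_int \<bar>i - j\<bar> powr (1 - \<alpha>))))"
      unfolding riesz_potential_def by (rule norm_infsum_bound) (simp only: norm_eq s)
    also have "\<dots> = infsum (f j) {i. i \<noteq> j}" by (simp only: norm_eq)
    also have "\<dots> \<le> infsum (f j) UNIV"
      using s summ f0 by (intro infsum_mono_neutral) auto
    finally show ?thesis .
  qed
  have "(\<Sum>j\<in>F. (cmod (riesz_potential \<alpha> a j) / (T * t)) powr q j) \<le> (\<Sum>j\<in>F. (infsum (f j) UNIV / (T * t)) powr q j)"
    using norm_le q \<open>0 < T\<close> \<open>0 < t\<close>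
    by (intro sum_mono powr_mono2 divide_right_mono) (auto intro: less_imp_le)
  also have "\<dots> \<le> 1"
  proof (rule tendsto_upperbound)
    have "((\<lambda>E. sum (f j) E) \<longlongrightarrow> infsum (f j) UNIV) (finite_subsets_at_top UNIV)" for j
      using has_sum_infsum[OF summ] by (simp add: has_sum_def)
    moreover have "eventually (\<lambda>E. 0 \<le> sum (f j) E / (T * t)) (finite_subsets_at_top UNIV)" for j
      using f0 \<open>0 < T\<close> \<open>0 < t\<close> by (auto intro!: always_eventually divide_nonneg_pos sum_nonneg)
    ultimately show "((\<lambda>E. \<Sum>j\<in>F. (sum (f j) E / (T * t)) powr q j) \<longlongrightarrow>
        (\<Sum>j\<in>F. (infsum (f j) UNIV / (T * t)) powr q j)) (finite_subsets_at_top UNIV)"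
      using q \<open>0 < T\<close> \<open>0 < t\<close>
      by (intro tendsto_sum tendsto_powr' tendsto_divide tendsto_const) auto
    show "eventually (\<lambda>E. (\<Sum>j\<in>F. (sum (f j) E / (T * t)) powr q j) \<le> 1) (finite_subsets_at_top UNIV)"
      using finite_bound \<open>finite F\<close> by (auto simp: eventually_finite_subsets_at_top)
  qed (rule finite_subsets_at_top_neq_bot)
  finally show ?thesis .
qed

text \<open>
  Whenever \<open>t\<close> is admissible in the infimum that defines the norm of \<open>a\<close>, the modular bound for
  \<open>a / t\<close> makes \<open>T * t\<close> admissible for \<open>I\<^sub>\<alpha> a\<close>; it remains to take the infimum over \<open>t\<close>.
\<close>

theorem theorem1p3:
  fixes \<alpha> s :: real and p q :: "int \<Rightarrow> real"
  assumes "0 < \<alpha>" and "\<alpha> < 1"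
    and "\<forall>i. 1 \<le> q i"
    and "1 / (1 - \<alpha>) < s" and "ereal s < exponent_lower q"
    and "conjugate_exponent (\<lambda>i. q i / s) \<in> exponents_B"
    and "\<forall>i. 1 / p i = 1 / q i + \<alpha>"
  shows "\<exists>C::real. C > 0 \<and>
    (\<forall>a \<in> vlp_space p. vlp_norm q (riesz_potential \<alpha> a) \<le> ennreal C * vlp_norm p a)"
proof -
  have qs: "s < q i" for i
  proof -
    have "exponent_lower q \<le> ereal (q i)" unfolding exponent_lower_def by (rule INF_lower) simp
    with assms(5) have "ereal s < ereal (q i)" by (rule less_le_trans)
    then show ?thesis by simp
  qed
  obtain T where T: "0 < T" and window:
    "\<And>a m n. (\<And>i. 0 \<le> a i) \<Longrightarrow> (\<And>F. finite F \<Longrightarrow> (\<Sum>i\<in>F. a i powr p i) \<le> 1) \<Longrightarrow>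
      (\<Sum>j = m..n. ((\<Sum>i = m..n. a i * real_of_int \<bar>i - j\<bar> powr (\<alpha> - 1)) / T) powr q j) \<le> 1"
    using riesz_window_modular_bound[of \<alpha> s q p] assms qs by blast
  have scaled: "vlp_norm q (riesz_potential \<alpha> a) / ennreal T \<le> vlp_norm p a" for a
    unfolding vlp_norm_def[of p a]
  proof (rule Inf_greatest, clarify)
    fix t :: real
    assume t: "0 < t" and "(\<Sum>\<^sub>\<infinity>i. ennreal (cmod (a i / complex_of_real t) powr p i)) \<le> 1"
    then have a: "(\<Sum>i\<in>F. (cmod (a i) / t) powr p i) \<le> 1" if "finite F" for F
      using that by (simp add: infsum_ennreal_le_1_iff norm_divide)
    have "0 < q i" for i using assms(3)[rule_format, of i] by simp
    then have "vlp_norm q (riesz_potential \<alpha> a) \<le> ennreal (T * t)"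
      using T t assms(2) a by (intro vlp_norm_leI riesz_potential_modular_bound window) auto
    then show "vlp_norm q (riesz_potential \<alpha> a) / ennreal T \<le> ennreal t"
      using T t by (intro divide_le_posI_ennreal) (auto simp: ennreal_mult)
  qed
  have "vlp_norm q (riesz_potential \<alpha> a) \<le> ennreal T * vlp_norm p a" for a
  proof -
    have "vlp_norm q (riesz_potential \<alpha> a) = vlp_norm q (riesz_potential \<alpha> a) * ennreal T / ennreal T"
      using T by (simp add: mult_divide_eq_ennreal)
    also have "\<dots> = ennreal T * (vlp_norm q (riesz_potential \<alpha> a) / ennreal T)"
      by (simp add: ennreal_times_divide mult.commute)
    also have "\<dots> \<le> ennreal T * vlp_norm p a" using scaled by (intro mult_left_mono) auto
    finally show ?thesis .
  qed
  then show ?thesis using T by blast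
qed

end
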